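(* Let $p>5$ be a prime and $n$ a positive integer. Suppose $p^{r}\mid n$ but $p^{r+1}\nmid n$ for some positive integer $r$. (i) If $r=1$, then \[\sum_{\substack{l_1+\cdots+l_5=n\\ l_1,\dots,l_5\in\mathcal{P}_p}}\frac{1}{l_1l_2l_3l_4l_5}\equiv -\frac{4!}{6}\Big(5\cdot\frac{n}{p}+\Big(\frac{n}{p}\Big)^{3}\Big)B_{p-5}\pmod{p}.\] (ii) If $r\ge 2$, then \[\sum_{\substack{l_1+\cdots+l_5=n\\ l_1,\dots,l_5\in\mathcal{P}_p}}\frac{1}{l_1l_2l_3l_4l_5}\equiv -\frac{5!}{6}\cdot\frac{n}{p}\,B_{p-5}\pmod{p^{r}}.\]
   Context: $\mathcal{P}_p$ denotes the set of positive integers prime to $p$. $B_n$ is the $n$-th Bernoulli number, defined by $\frac{x}{e^x-1}=\sum_{n\ge 0}B_n\frac{x^n}{n!}$. Congruences are in the ring of rationals whose denominators are prime to $p$. *)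

theory Defs
  imports "HOL-Computational_Algebra.Computational_Algebra"
begin

definition bernoulli_fps :: "rat fps" where
  "bernoulli_fps = fps_X / (fps_exp 1 - 1)"

text \<open>
  The divisor has vanishing constant coefficient, hence is not a unit; the division of
  power series is nevertheless exact, so \<^const>\<open>bernoulli_fps\<close> really is the quotient
  $x / (e^x - 1)$.
\<close>

lemma bernoulli_fps_mult: "bernoulli_fps * (fps_exp 1 - 1) = fps_X"
proof -
  have nz: "(fps_exp 1 - 1 :: rat fps) $ 1 \<noteq> 0" by simp
  hence "(fps_exp 1 - 1 :: rat fps) \<noteq> 0" by force
  moreover have "subdegree (fps_exp 1 - 1 :: rat fps) \<le> subdegree (fps_X :: rat fps)"
    using subdegree_leI[OF nz] by simp
  ultimately have "(fps_exp 1 - 1 :: rat fps) dvd fps_X"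
    by (simp add: fps_dvd_iff)
  thus ?thesis by (simp add: bernoulli_fps_def)
qed

definition bernoulli :: "nat \<Rightarrow> rat" where
  "bernoulli n = fact n * fps_nth bernoulli_fps n"

definition pos_prime_to :: "nat \<Rightarrow> nat set" where
  "pos_prime_to p = {l. 0 < l \<and> coprime l p}"

definition local_ints :: "nat \<Rightarrow> rat set" where
  "local_ints p = {x. coprime (snd (quotient_of x)) (int p)}"

text \<open>
  Congruence modulo \<open>m\<close> in the ring \<^term>\<open>local_ints p\<close>; both sides are required to lie
  in that ring.
\<close>

definition local_cong :: "nat \<Rightarrow> rat \<Rightarrow> rat \<Rightarrow> nat \<Rightarrow> bool" where
  "local_cong p x y m \<longleftrightarrow>
     x \<in> local_ints p \<and> y \<in> local_ints p \<and> (\<exists>z\<in>local_ints p. x - y = of_nat m * z)"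

definition recip_sum5 :: "nat \<Rightarrow> nat \<Rightarrow> rat" where
  "recip_sum5 p n =
     (\<Sum>(l1, l2, l3, l4, l5) \<in> {(l1, l2, l3, l4, l5).
         l1 \<in> pos_prime_to p \<and> l2 \<in> pos_prime_to p \<and> l3 \<in> pos_prime_to p \<and>
         l4 \<in> pos_prime_to p \<and> l5 \<in> pos_prime_to p \<and> l1 + l2 + l3 + l4 + l5 = n}.
       1 / (of_nat l1 * of_nat l2 * of_nat l3 * of_nat l4 * of_nat l5))"

text \<open>The index set is finite, so the sum is not the default value 0 of an infinite sum.\<close>

lemma finite_recip_sum5_index:
  "finite {(l1, l2, l3, l4, l5).
     l1 \<in> pos_prime_to p \<and> l2 \<in> pos_prime_to p \<and> l3 \<in> pos_prime_to p \<and>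
     l4 \<in> pos_prime_to p \<and> l5 \<in> pos_prime_to p \<and> l1 + l2 + l3 + l4 + l5 = n}"
  by (rule finite_subset[of _ "{..n} \<times> {..n} \<times> {..n} \<times> {..n} \<times> {..n}"]) auto

end

theory Submission
  imports Defs "HOL-Number_Theory.Residues"
begin

text \<open>
  Write $q = p^r$ and split the summation variables by their residues modulo \<open>q\<close>. With
  $y = x^q$ the series $\sum_{p \nmid l} x^l / l$ is congruent to $f(x) / (1 - y)$ modulo
  \<open>q\<close>, where \<open>f\<close> is its truncation at degree \<open>q\<close>. Hence the sum for \<open>n = q m\<close> is
  congruent to $\sum_{s=1}^4 \binom{m - s + 4}{4} T_s$, where $T_s$ is the coefficient of
  $x^{q s}$ in $f^5$. Since $T_{5-s} \equiv - T_s$, only $T_1$ and $T_2$ matter, with weights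
  $(m^3 + m) / 2$ and $(m^3 - m) / 6$.

  For \<open>r = 1\<close> the polynomial \<open>f\<close> is congruent to $(1 - x^p - (1 - x)^p) / p$ modulo \<open>p\<close>,
  which expresses $T_1$ and $T_2$ by the binomial coefficients $\binom{p k}{p} = k E(k)$,
  $E(x) = \prod_{0 < i < p} (1 - p x / i)$. The symmetry $E(1 - x) = E(x)$ determines \<open>E\<close>
  modulo $p^6$ up to two parameters, of which only the fourth elementary symmetric function
  of the reciprocals survives; Newton's identities and the power sums evaluate it, and the
  outcome is $T_1 \equiv - 24 B_{p-5}$ and $T_2 \equiv 48 B_{p-5}$.

  For \<open>r \<ge> 2\<close>, differentiating $f^5$ shows that $\sum_s s T_s \equiv 0$, that is
  $T_2 \equiv - 3 T_1$, which removes the cubic term in \<open>m\<close>. A second-order expansion at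
  \<open>m = p\<close> passes from \<open>r\<close> to \<open>r + 1\<close> and gives $T_1 \equiv - 20 p^{r-1} B_{p-5}$.
\<close>

section \<open>The ring of rationals with denominator prime to \<open>p\<close>\<close>

locale prime_localization =
  fixes p :: nat
  assumes prime_p: "prime p"
begin

abbreviation Z :: "rat set" where "Z \<equiv> local_ints p"

text \<open>The definition refers to the reduced denominator, which is awkward for sums and
  products. It divides every other denominator of the same number, so any representation with a
  denominator prime to \<open>p\<close> will do.\<close>

lemma local_ints_iff:
  "x \<in> Z \<longleftrightarrow> (\<exists>a b. coprime b (int p) \<and> x = of_int a / of_int b)"
proof
  assume "x \<in> Z"
  moreover have "x = of_int (fst (quotient_of x)) / of_int (snd (quotient_of x))"
    by (metis prod.collapse quotient_of_div)
  ultimately show "\<exists>a b. coprime b (int p) \<and> x = of_int a / of_int b"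
    unfolding local_ints_def by blast
next
  assume "\<exists>a b. coprime b (int p) \<and> x = of_int a / of_int b"
  then obtain a b where ab: "coprime b (int p)" "x = of_int a / of_int b" by blast
  obtain c d where cd: "quotient_of x = (c, d)" by fastforce
  have d: "d > 0" "coprime c d" "x = of_int c / of_int d"
    using cd by (auto simp: quotient_of_denom_pos quotient_of_coprime quotient_of_div)
  have "b \<noteq> 0" using ab(1) prime_p by (auto simp: prime_nat_iff)
  then have "of_int (a * d) = (of_int (c * b) :: rat)"
    using ab(2) d by (simp add: field_simps)
  then have "a * d = c * b" by linarith
  then have "d dvd b"
    using d(2) by (metis coprime_commute coprime_dvd_mult_right_iff dvd_triv_right)
  then have "coprime d (int p)" using ab(1) by (metis coprime_divisors dvd_refl)
  then show "x \<in> Z" by (simp add: local_ints_def cd)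
qed

lemma local_of_int [simp, intro]: "of_int a \<in> Z"
  unfolding local_ints_iff by (rule exI[of _ a], rule exI[of _ 1]) simp

lemma local_of_nat [simp, intro]: "of_nat a \<in> Z"
  using local_of_int[of "int a"] by simp

lemma local_numeral [simp, intro]: "numeral a \<in> Z" "0 \<in> Z" "1 \<in> Z"
  using local_of_nat[of "numeral a"] local_of_nat[of 0] local_of_nat[of 1] by simp_all

lemma local_mult [simp, intro]: assumes "x \<in> Z" "y \<in> Z" shows "x * y \<in> Z"
proof -
  from assms obtain a b c d where
    "coprime b (int p)" "x = of_int a / of_int b" "coprime d (int p)" "y = of_int c / of_int d"
    unfolding local_ints_iff by blast
  then have "coprime (b * d) (int p)" "x * y = of_int (a * c) / of_int (b * d)" by simp_all
  then show ?thesis unfolding local_ints_iff by blast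
qed

lemma local_uminus [simp, intro]: assumes "x \<in> Z" shows "- x \<in> Z"
  using local_mult[OF local_of_int[of "-1"] assms] by simp

lemma local_add [simp, intro]: assumes "x \<in> Z" "y \<in> Z" shows "x + y \<in> Z"
proof -
  from assms obtain a b c d where
    *: "coprime b (int p)" "x = of_int a / of_int b" "coprime d (int p)" "y = of_int c / of_int d"
    unfolding local_ints_iff by blast
  have "b \<noteq> 0" "d \<noteq> 0" using * prime_p by (auto simp: prime_nat_iff)
  then have "coprime (b * d) (int p)" "x + y = of_int (a * d + c * b) / of_int (b * d)"
    using * by (simp_all add: field_simps)
  then show ?thesis unfolding local_ints_iff by blast
qed

lemma local_diff [simp, intro]: "x \<in> Z \<Longrightarrow> y \<in> Z \<Longrightarrow> x - y \<in> Z"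
  using local_add[of x "- y"] by simp

lemma local_power [simp, intro]: "x \<in> Z \<Longrightarrow> x ^ n \<in> Z"
  by (induction n) auto

lemma local_sum [intro]: "(\<And>i. i \<in> A \<Longrightarrow> f i \<in> Z) \<Longrightarrow> sum f A \<in> Z"
  by (induction A rule: infinite_finite_induct) auto

lemma local_inverse [simp, intro]: "coprime n p \<Longrightarrow> 1 / of_nat n \<in> Z"
  unfolding local_ints_iff by (rule exI[of _ 1], rule exI[of _ "int n"]) simp

lemma local_divide [simp, intro]:
  "x \<in> Z \<Longrightarrow> coprime n p \<Longrightarrow> x / of_nat n \<in> Z"
  using local_mult[OF _ local_inverse, of x n] by simp

lemma p_pos [simp]: "0 < p" "p \<noteq> 0" "p \<noteq> Suc 0"
  using prime_p prime_gt_0_nat by (auto simp: prime_nat_iff)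

lemma coprime_p_iff: "coprime n p \<longleftrightarrow> \<not> p dvd n"
  using prime_p by (metis coprime_commute dvd_refl not_coprimeI not_prime_unit prime_imp_coprime)

lemma coprime_p_less: "0 < n \<Longrightarrow> n < p \<Longrightarrow> coprime n p"
  by (auto simp: coprime_p_iff dest: dvd_imp_le)

lemma coprime_p_pos: "coprime n p \<Longrightarrow> 0 < n"
  by (rule ccontr) simp

lemma coprime_p_fact: "n < p \<Longrightarrow> coprime (fact n) p"
  using prime_p by (simp add: coprime_p_iff prime_dvd_fact_iff)

section \<open>Powers of the ideal generated by \<open>p\<close>, and congruences modulo
  them\<close>

definition pideal :: "nat \<Rightarrow> rat set" where
  "pideal k = {x. x / of_nat p ^ k \<in> Z}"

lemma pideal_0 [simp]: "pideal 0 = Z"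
  by (simp add: pideal_def)

lemma pideal_iff: "x \<in> pideal k \<longleftrightarrow> (\<exists>z\<in>Z. x = of_nat p ^ k * z)"
proof
  assume "x \<in> pideal k"
  then have "x / of_nat p ^ k \<in> Z" "x = of_nat p ^ k * (x / of_nat p ^ k)"
    by (simp_all add: pideal_def)
  then show "\<exists>z\<in>Z. x = of_nat p ^ k * z" by blast
qed (auto simp: pideal_def)

lemma pideal_mult: "x \<in> pideal i \<Longrightarrow> y \<in> pideal j \<Longrightarrow> x * y \<in> pideal (i + j)"
  unfolding pideal_def using local_mult[of "x / of_nat p ^ i" "y / of_nat p ^ j"]
  by (simp add: power_add)

lemma pideal_mult_right: "x \<in> pideal k \<Longrightarrow> y \<in> Z \<Longrightarrow> x * y \<in> pideal k"
  using pideal_mult[of x k y 0] by simp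

lemma pideal_mult_left: "x \<in> Z \<Longrightarrow> y \<in> pideal k \<Longrightarrow> x * y \<in> pideal k"
  using pideal_mult[of x 0 y k] by simp

lemma pideal_zero [simp, intro]: "0 \<in> pideal k"
  by (simp add: pideal_def)

lemma pideal_add [intro]: "x \<in> pideal k \<Longrightarrow> y \<in> pideal k \<Longrightarrow> x + y \<in> pideal k"
  unfolding pideal_def by (simp add: add_divide_distrib)

lemma pideal_uminus [intro]: "x \<in> pideal k \<Longrightarrow> - x \<in> pideal k"
  unfolding pideal_def using local_uminus[of "x / of_nat p ^ k"] by simp

lemma pideal_diff [intro]: "x \<in> pideal k \<Longrightarrow> y \<in> pideal k \<Longrightarrow> x - y \<in> pideal k"
  unfolding pideal_def by (simp add: diff_divide_distrib)

lemma pideal_sum [intro]: "(\<And>i. i \<in> A \<Longrightarrow> f i \<in> pideal k) \<Longrightarrow> sum f A \<in> pideal k"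
  by (induction A rule: infinite_finite_induct) auto

lemma pideal_p_power [simp, intro]: "of_nat p ^ k \<in> pideal k"
  by (simp add: pideal_def)

lemma pideal_p [simp, intro]: "of_nat p \<in> pideal 1"
  by (simp add: pideal_def)

lemma pideal_mono: assumes "x \<in> pideal j" "i \<le> j" shows "x \<in> pideal i"
proof -
  from assms(1) obtain z where z: "z \<in> Z" "x = of_nat p ^ j * z" by (auto simp: pideal_iff)
  then have "x = of_nat p ^ i * (of_nat p ^ (j - i) * z)"
    using assms(2) by (simp flip: power_add mult.assoc)
  then show ?thesis using z(1) unfolding pideal_iff by blast
qed

lemma pideal_local: "x \<in> pideal k \<Longrightarrow> x \<in> Z"
  using pideal_mono[of x k 0] by simp

lemma pideal_cancel_p: "of_nat p ^ i * x \<in> pideal (i + k) \<longleftrightarrow> x \<in> pideal k"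
  by (simp add: pideal_def power_add)

lemma pideal_cancel_unit:
  assumes n: "coprime n p"
  shows "of_nat n * x \<in> pideal k \<longleftrightarrow> x \<in> pideal k"
proof
  assume "of_nat n * x \<in> pideal k"
  then have "1 / of_nat n * (of_nat n * x) \<in> pideal k" by (rule pideal_mult_left[OF local_inverse[OF n]])
  then show "x \<in> pideal k" using coprime_p_pos[OF n] by simp
qed (simp add: pideal_mult_left)

lemma pideal_of_nat: "p dvd n \<Longrightarrow> of_nat n \<in> pideal 1"
  using pideal_mult_right[OF pideal_p] by (auto elim!: dvdE)

text \<open>Neither side has to be \<open>p\<close>-integral, which keeps sums and transitivity free
  of side conditions; integrality is asked for only where products are formed.\<close>

definition pcong :: "nat \<Rightarrow> rat \<Rightarrow> rat \<Rightarrow> bool" where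
  "pcong k x y \<longleftrightarrow> x - y \<in> pideal k"

lemma pcong_refl [simp, intro]: "pcong k x x"
  by (simp add: pcong_def)

lemma pcong_sym: "pcong k x y \<Longrightarrow> pcong k y x"
  unfolding pcong_def using pideal_uminus[of "x - y" k] by simp

lemma pcong_trans [trans]: "pcong k x y \<Longrightarrow> pcong k y z \<Longrightarrow> pcong k x z"
  unfolding pcong_def using pideal_add[of "x - y" k "y - z"] by simp

lemma pcong_add: "pcong k x y \<Longrightarrow> pcong k u v \<Longrightarrow> pcong k (x + u) (y + v)"
  unfolding pcong_def by (metis add_diff_add pideal_add)

lemma pcong_uminus: "pcong k x y \<Longrightarrow> pcong k (- x) (- y)"
  unfolding pcong_def using pideal_uminus[of "x - y" k] by simp

lemma pcong_diff: "pcong k x y \<Longrightarrow> pcong k u v \<Longrightarrow> pcong k (x - u) (y - v)"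
  using pcong_add[OF _ pcong_uminus, of k x y u v] by simp

lemma pcong_mult:
  assumes "pcong k x y" "pcong k u v" "y \<in> Z" "u \<in> Z"
  shows "pcong k (x * u) (y * v)"
proof -
  have "x * u - y * v = (x - y) * u + y * (u - v)" by (simp add: algebra_simps)
  with assms show ?thesis
    unfolding pcong_def by (auto intro: pideal_mult_left pideal_mult_right)
qed

lemma pcong_mult_left: "z \<in> Z \<Longrightarrow> pcong k x y \<Longrightarrow> pcong k (z * x) (z * y)"
  unfolding pcong_def using pideal_mult_left[of z "x - y" k] by (simp add: algebra_simps)

lemma pcong_sum: "(\<And>i. i \<in> A \<Longrightarrow> pcong k (f i) (g i)) \<Longrightarrow> pcong k (sum f A) (sum g A)"
  unfolding pcong_def sum_subtractf[symmetric] by (rule pideal_sum)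

lemma pcong_mono: "pcong j x y \<Longrightarrow> i \<le> j \<Longrightarrow> pcong i x y"
  unfolding pcong_def by (rule pideal_mono)

lemma pcong_local: "pcong k x y \<Longrightarrow> y \<in> Z \<Longrightarrow> x \<in> Z"
  unfolding pcong_def using local_add[OF pideal_local, of "x - y" k y] by simp

lemma pcong_0_iff: "pcong k x 0 \<longleftrightarrow> x \<in> pideal k"
  by (simp add: pcong_def)

lemma pcong_cancel_p:
  "pcong (i + k) (of_nat p ^ i * x) (of_nat p ^ i * y) \<longleftrightarrow> pcong k x y"
  unfolding pcong_def using pideal_cancel_p[of i "x - y" k] by (simp add: algebra_simps)

text \<open>Integrality of \<open>x\<close> follows from the congruence and the integrality of
  \<open>y\<close>.\<close>

lemma local_cong_iff_pcong:
  "local_cong p x y (p ^ k) \<longleftrightarrow> pcong k x y \<and> y \<in> Z"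
  unfolding local_cong_def pcong_def
  using pcong_local[of k x y] by (simp add: pideal_iff pcong_def) blast

subsection \<open>Congruences of power series\<close>

definition fps_local :: "rat fps \<Rightarrow> bool" where
  "fps_local F \<longleftrightarrow> (\<forall>n. fps_nth F n \<in> Z)"

definition fps_pcong :: "nat \<Rightarrow> rat fps \<Rightarrow> rat fps \<Rightarrow> bool" where
  "fps_pcong k F G \<longleftrightarrow> (\<forall>n. pcong k (fps_nth F n) (fps_nth G n))"

lemma fps_local_mult [intro]: "fps_local F \<Longrightarrow> fps_local G \<Longrightarrow> fps_local (F * G)"
  unfolding fps_local_def fps_mult_nth by auto

lemma fps_local_basic [simp, intro]:
  "fps_local 1" "fps_local (fps_X ^ n)" "z \<in> Z \<Longrightarrow> fps_local (fps_const z)"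
  unfolding fps_local_def by auto

lemma fps_local_diff [intro]: "fps_local F \<Longrightarrow> fps_local G \<Longrightarrow> fps_local (F - G)"
  unfolding fps_local_def by auto

lemma fps_local_power [intro]: "fps_local F \<Longrightarrow> fps_local (F ^ n)"
  by (induction n) auto

lemma fps_pcong_trans [trans]:
  "fps_pcong k F G \<Longrightarrow> fps_pcong k G H \<Longrightarrow> fps_pcong k F H"
  unfolding fps_pcong_def using pcong_trans by blast

lemma fps_pcong_refl [simp, intro]: "fps_pcong k F F"
  unfolding fps_pcong_def by auto

lemma fps_pcong_mult:
  assumes "fps_pcong k F G" "fps_pcong k A B" "fps_local G" "fps_local A"
  shows "fps_pcong k (F * A) (G * B)"
  using assms unfolding fps_pcong_def fps_local_def fps_mult_nth
  by (auto intro!: pcong_sum pcong_mult)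

lemma fps_pcong_local: "fps_pcong k F G \<Longrightarrow> fps_local G \<Longrightarrow> fps_local F"
  unfolding fps_pcong_def fps_local_def using pcong_local by blast

lemma fps_pcong_power:
  assumes "fps_pcong k F G" "fps_local G"
  shows "fps_pcong k (F ^ n) (G ^ n)"
proof (induction n)
  case (Suc n)
  have "fps_local F" using assms by (rule fps_pcong_local)
  with Suc assms show ?case by (auto intro!: fps_pcong_mult)
qed simp

end

subsection \<open>Powers of geometric series\<close>

definition monomial_sum :: "nat set \<Rightarrow> (nat \<Rightarrow> rat) \<Rightarrow> rat fps" where
  "monomial_sum A w = (\<Sum>a\<in>A. fps_const (w a) * fps_X ^ a)"

lemma monomial_mult_monomial_sum:
  "(fps_const c * fps_X ^ m) * monomial_sum A w =
     (\<Sum>a\<in>A. fps_const (c * w a) * fps_X ^ (m + a))"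
  by (simp add: monomial_sum_def sum_distrib_left power_add mult_ac flip: fps_const_mult)

lemma monomial_sum_nth:
  "finite A \<Longrightarrow> monomial_sum A w $ n = (if n \<in> A then w n else 0)"
  by (simp add: monomial_sum_def fps_sum_nth if_distrib cong: if_cong)

lemma monomial_sum_prod5_nth:
  "(monomial_sum A u * monomial_sum A v * monomial_sum A w * monomial_sum A x
      * monomial_sum A y) $ N =
   (\<Sum>a\<in>A. \<Sum>b\<in>A. \<Sum>c\<in>A. \<Sum>d\<in>A. \<Sum>e\<in>A.
      if a + b + c + d + e = N then u a * v b * w c * x d * y e else 0)"
proof -
  have "monomial_sum A u * monomial_sum A v * monomial_sum A w * monomial_sum A x
      * monomial_sum A y = (\<Sum>a\<in>A. \<Sum>b\<in>A. \<Sum>c\<in>A. \<Sum>d\<in>A. \<Sum>e\<in>A.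
      fps_const (u a * v b * w c * x d * y e) * fps_X ^ (a + b + c + d + e))"
    \<comment> \<open>Only the first factor is unfolded: each further factor then meets a monomial
      on its left, where \<open>monomial_mult_monomial_sum\<close> applies.\<close>
    by (subst monomial_sum_def[of A u])
       (simp only: sum_distrib_right monomial_mult_monomial_sum)
  then show ?thesis
    by (simp add: fps_sum_nth if_distrib eq_commute cong: if_cong)
qed

text \<open>Lets an infinite series be exchanged for its truncation when one coefficient of a power
  is read off.\<close>

lemma fps_power_nth_cong:
  fixes F G :: "rat fps"
  assumes "\<And>i. i \<le> n \<Longrightarrow> F $ i = G $ i"
  shows "(F ^ k) $ n = (G ^ k) $ n"
proof -
  have "\<forall>i\<le>n. (F ^ k) $ i = (G ^ k) $ i"
  proof (induction k)
    case (Suc k)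
    then show ?case using assms by (auto simp: fps_mult_nth intro!: sum.cong)
  qed simp
  then show ?thesis by simp
qed

text \<open>Supports add under multiplication. This serves to bound the exponents of fivefold
  products of polynomials of degree below \<open>q\<close>.\<close>

lemma fps_mult_nth_eq_0:
  fixes F G :: "rat fps"
  assumes F: "\<And>i. F $ i \<noteq> 0 \<Longrightarrow> a \<le> i \<and> i \<le> b"
    and G: "\<And>i. G $ i \<noteq> 0 \<Longrightarrow> c \<le> i \<and> i \<le> d"
    and "(F * G) $ n \<noteq> 0"
  shows "a + c \<le> n \<and> n \<le> b + d"
proof (rule ccontr)
  assume n: "\<not> ?thesis"
  have "F $ i * G $ (n - i) = 0" if "i \<le> n" for i
    using F[of i] G[of "n - i"] n that by (cases "F $ i = 0"; cases "G $ (n - i) = 0") auto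
  then have "(F * G) $ n = 0" unfolding fps_mult_nth by (intro sum.neutral) simp
  with assms(3) show False by simp
qed

lemma fps_power_nth_eq_0:
  fixes F :: "rat fps"
  assumes F: "\<And>i. F $ i \<noteq> 0 \<Longrightarrow> a \<le> i \<and> i \<le> b" and "(F ^ k) $ n \<noteq> 0"
  shows "k * a \<le> n \<and> n \<le> k * b"
  using assms(2)
proof (induction k arbitrary: n)
  case (Suc k)
  then show ?case using fps_mult_nth_eq_0[of F a b "F ^ k" "k * a" "k * b" n] F by simp
qed (simp split: if_splits)

lemma mult_one_minus_X_power_nth:
  "(F * (1 - fps_X ^ q)) $ n = F $ n - (if n < q then 0 else F $ (n - q) :: rat)"
  by (simp add: right_diff_distrib fps_X_power_mult_right_nth)

text \<open>The series of $(1 - x^q)^{-(k+1)}$.\<close>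

definition geometric_power :: "nat \<Rightarrow> nat \<Rightarrow> rat fps" where
  "geometric_power q k =
     Abs_fps (\<lambda>n. if q dvd n then of_nat ((n div q + k) choose k) else 0)"

text \<open>The second identity is Pascal's rule at the multiples of \<open>q\<close>.\<close>

lemma geometric_power_step:
  assumes q: "q > 0"
  shows "geometric_power q 0 * (1 - fps_X ^ q) = 1"
    and "geometric_power q (Suc k) * (1 - fps_X ^ q) = geometric_power q k"
proof -
  show "geometric_power q 0 * (1 - fps_X ^ q) = 1"
    unfolding fps_eq_iff mult_one_minus_X_power_nth
    using q by (auto simp: geometric_power_def dvd_minus_self dest: dvd_imp_le)
  show "geometric_power q (Suc k) * (1 - fps_X ^ q) = geometric_power q k"
  proof (unfold fps_eq_iff mult_one_minus_X_power_nth, rule allI)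
    fix n
    show "geometric_power q (Suc k) $ n
        - (if n < q then 0 else geometric_power q (Suc k) $ (n - q)) = geometric_power q k $ n"
    proof (cases "q dvd n")
      case True
      then obtain j where "n = q * j" by blast
      with q show ?thesis
        by (cases j) (simp_all add: geometric_power_def right_diff_distrib' flip: of_nat_add)
    next
      case False
      with q have "n \<ge> q \<Longrightarrow> \<not> q dvd n - q"
        by (metis dvd_diffD1 dvd_refl le_add_diff_inverse dvd_add)
      with False show ?thesis by (simp add: geometric_power_def)
    qed
  qed
qed

lemma geometric_power_mult:
  assumes "q > 0"
  shows "geometric_power q k * (1 - fps_X ^ q) ^ Suc k = 1"
proof (induction k)
  case 0
  show ?case using geometric_power_step(1)[OF assms] by simp
next
  case (Suc k)
  have "geometric_power q (Suc k) * (1 - fps_X ^ q) ^ Suc (Suc k) =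
    (geometric_power q (Suc k) * (1 - fps_X ^ q)) * (1 - fps_X ^ q) ^ Suc k"
    by (subst power_Suc) (simp only: mult.assoc)
  then show ?case by (simp only: Suc geometric_power_step(2)[OF assms])
qed

lemma geometric_power_cancel:
  assumes "q > 0"
  shows "(1 - fps_X ^ q) ^ j * geometric_power q (j + k) = geometric_power q k"
proof (induction j)
  case (Suc j)
  have "(1 - fps_X ^ q) ^ Suc j * geometric_power q (Suc j + k) =
      (1 - fps_X ^ q) ^ j * (geometric_power q (Suc (j + k)) * (1 - fps_X ^ q))"
    by (simp add: mult_ac)
  then show ?case by (simp only: Suc geometric_power_step(2)[OF assms])
qed simp

text \<open>The second factor is supported on multiples of \<open>q\<close>, so in the convolution
  only the coefficients of \<open>G\<close> at multiples of \<open>q\<close> survive.\<close>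

lemma fps_mult_geometric_power_nth:
  assumes q: "q > 0"
  shows "(G * geometric_power q k) $ (q * m) =
    (\<Sum>s\<le>m. G $ (q * s) * of_nat ((m - s + k) choose k))"
proof -
  have "(G * geometric_power q k) $ (q * m) =
      (\<Sum>i=0..q * m. G $ i * geometric_power q k $ (q * m - i))"
    by (simp add: fps_mult_nth)
  also have "\<dots> = (\<Sum>i\<in>(\<lambda>s. q * s) ` {..m}. G $ i * geometric_power q k $ (q * m - i))"
  proof (rule sum.mono_neutral_right)
    show "\<forall>i\<in>{0..q * m} - (\<lambda>s. q * s) ` {..m}. G $ i * geometric_power q k $ (q * m - i) = 0"
    proof
      fix i assume i: "i \<in> {0..q * m} - (\<lambda>s. q * s) ` {..m}"
      have "\<not> q dvd q * m - i"
      proof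
        assume "q dvd q * m - i"
        then have "q dvd i" using i by (metis DiffD1 atLeastAtMost_iff dvd_diffD1 dvd_triv_left)
        then show False using i q by (auto elim!: dvdE)
      qed
      then show "G $ i * geometric_power q k $ (q * m - i) = 0"
        by (simp add: geometric_power_def)
    qed
  qed (use q in auto)
  also have "\<dots> = (\<Sum>s\<le>m. G $ (q * s) * geometric_power q k $ (q * m - q * s))"
    using q by (subst sum.reindex) (auto simp: inj_on_def)
  also have "\<dots> = (\<Sum>s\<le>m. G $ (q * s) * of_nat ((m - s + k) choose k))"
    using q by (intro sum.cong) (simp_all add: geometric_power_def flip: diff_mult_distrib2)
  finally show ?thesis .
qed

lemma of_nat_choose_4:
  "(of_nat ((n + 4) choose 4) :: rat) =
     (of_nat n + 1) * (of_nat n + 2) * (of_nat n + 3) * (of_nat n + 4) / 24"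
  by (simp add: binomial_gbinomial gbinomial_prod_rev numeral_eq_Suc atLeast0_lessThan_Suc
      field_simps)

lemma of_nat_choose_5:
  "(of_nat ((n + 5) choose 5) :: rat) =
     (of_nat n + 1) * (of_nat n + 2) * (of_nat n + 3) * (of_nat n + 4) * (of_nat n + 5) / 120"
  by (simp add: binomial_gbinomial gbinomial_prod_rev numeral_eq_Suc atLeast0_lessThan_Suc
      field_simps)

section \<open>The sum as a coefficient of the fifth power of the reciprocal series\<close>

definition recip_fps :: "nat \<Rightarrow> rat fps" where
  "recip_fps p = Abs_fps (\<lambda>l. if coprime l p then 1 / of_nat l else 0)"

lemma recip_fps_nth: "recip_fps p $ l = (if coprime l p then 1 / of_nat l else 0)"
  by (simp add: recip_fps_def)

lemma recip_sum5_eq_nth: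
  assumes "p \<noteq> 1"
  shows "recip_sum5 p n = (recip_fps p ^ 5) $ n"
proof -
  define A where "A = {l. l \<le> n \<and> coprime l p}"
  define w :: "nat \<Rightarrow> rat" where "w l = 1 / of_nat l" for l
  have A0: "l \<in> pos_prime_to p \<longleftrightarrow> coprime l p" for l
    using assms by (auto simp: pos_prime_to_def intro!: Nat.gr0I)
  have fin: "finite A" by (simp add: A_def)
  \<comment> \<open>Every summation variable is at most \<open>n\<close>, so the index set lies in a
    finite box and the condition on the total moves into the summand.\<close>
  have "recip_sum5 p n = (\<Sum>(a, b, c, d, e) \<in> A \<times> A \<times> A \<times> A \<times> A.
      if a + b + c + d + e = n then w a * w b * w c * w d * w e else 0)"
    unfolding recip_sum5_def
    by (rule sum.mono_neutral_cong_left) (auto simp: fin w_def A0 A_def split: if_splits)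
  also have "\<dots> = (monomial_sum A w ^ 5) $ n"
    by (simp add: monomial_sum_prod5_nth[symmetric] eval_nat_numeral mult.assoc
        flip: sum.cartesian_product)
  also have "\<dots> = (recip_fps p ^ 5) $ n"
    by (rule fps_power_nth_cong) (auto simp: monomial_sum_nth fin recip_fps_def A_def w_def)
  finally show ?thesis .
qed

subsection \<open>Reduction to residues modulo a power of \<open>p\<close>\<close>

locale prime_gt_5 = prime_localization +
  assumes p_gt_5: "p > 5"
begin

abbreviation units :: "nat \<Rightarrow> nat set" where
  "units q \<equiv> {b. b < q \<and> coprime b p}"

definition trunc :: "nat \<Rightarrow> rat fps" where
  "trunc q = monomial_sum (units q) (\<lambda>b. 1 / of_nat b)"

definition T :: "nat \<Rightarrow> nat \<Rightarrow> rat" where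
  "T q s = (trunc q ^ 5) $ (q * s)"

lemma finite_units [simp]: "finite (units q)"
  by simp

lemma trunc_nth: "trunc q $ l = (if l < q \<and> coprime l p then 1 / of_nat l else 0)"
  by (simp add: trunc_def monomial_sum_nth)

lemma trunc_local [intro, simp]: "fps_local (trunc q)"
  unfolding fps_local_def trunc_nth by auto

lemma geometric_power_local [intro, simp]: "fps_local (geometric_power q k)"
  unfolding fps_local_def geometric_power_def by auto

lemma one_minus_X_power_local [intro, simp]: "fps_local (1 - fps_X ^ q)"
  by (intro fps_local_diff) simp_all

lemma T_local [simp, intro]: "T q s \<in> Z"
  using fps_local_power[OF trunc_local] by (simp add: T_def fps_local_def)

lemma trunc_nonzero: "trunc q $ i \<noteq> 0 \<Longrightarrow> 1 \<le> i \<and> i \<le> q - 1"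
  by (auto simp: trunc_nth dest: coprime_p_pos split: if_splits)

text \<open>A multiple of \<open>q\<close> between 5 and 5(q - 1) is one of q, 2q, 3q, 4q. The
  series is left general because both \<open>trunc q ^ 5\<close> and
  \<open>trunc2 q * trunc q ^ 4\<close> are used.\<close>

lemma nth_eq_0_outside:
  assumes "q > 0" "\<And>n. F $ n \<noteq> 0 \<Longrightarrow> 5 \<le> n \<and> n \<le> 5 * (q - 1)" "s \<notin> {1..4}"
  shows "F $ (q * s) = (0 :: rat)"
proof (rule ccontr)
  assume "F $ (q * s) \<noteq> 0"
  then have *: "5 \<le> q * s" "q * s \<le> 5 * (q - 1)" using assms(2) by auto
  have "s < 5"
  proof (rule ccontr)
    assume "\<not> s < 5"
    then have "q * s \<ge> q * 5" by (intro mult_left_mono) auto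
    moreover have "5 * (q - 1) < q * 5" using assms(1) by simp
    ultimately show False using *(2) by linarith
  qed
  moreover have "s \<noteq> 0" using *(1) by (intro notI) simp
  ultimately show False using assms(3) by simp
qed

lemma T_eq_0: "q > 0 \<Longrightarrow> s \<notin> {1..4} \<Longrightarrow> T q s = 0"
  unfolding T_def
  by (rule nth_eq_0_outside) (use fps_power_nth_eq_0[of "trunc q" 1 "q - 1" 5, OF trunc_nonzero] in auto)

text \<open>Here \<open>e\<close> stands for binomial weights, meaningful for
  \<open>s \<le> m\<close>, and \<open>d\<close> for their polynomial extension. The zeros of
  \<open>c\<close> and \<open>d\<close> allow a summation range independent of
  \<open>m\<close>.\<close>

lemma sum_atMost_1_4:
  fixes c :: "nat \<Rightarrow> rat"
  assumes "\<And>s. s \<notin> {1..4} \<Longrightarrow> c s = 0" "\<And>s. s \<in> {1..4} \<Longrightarrow> s > m \<Longrightarrow> d s = 0"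
    "\<And>s. s \<le> m \<Longrightarrow> e s = d s"
  shows "(\<Sum>s\<le>m. c s * e s) = (\<Sum>s=1..4. c s * d s)"
proof -
  have "(\<Sum>s\<le>m. c s * e s) = (\<Sum>s\<in>{..m} \<inter> {1..4}. c s * d s)"
    using assms by (intro sum.mono_neutral_cong_right) auto
  also have "\<dots> = (\<Sum>s=1..4. c s * d s)"
    using assms by (intro sum.mono_neutral_left) auto
  finally show ?thesis .
qed

text \<open>The polynomial form of the binomial coefficient vanishes at s = m + 1, ..., m + 4, where
  the truncated subtraction would give the weight 1.\<close>

lemma sum_T_choose_4:
  assumes q0: "q > 0"
  shows "(\<Sum>s\<le>m. T q s * of_nat ((m - s + 4) choose 4)) =
    (\<Sum>s=1..4. T q s * ((of_nat m - of_nat s + 1) * (of_nat m - of_nat s + 2)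
        * (of_nat m - of_nat s + 3) * (of_nat m - of_nat s + 4) / 24))"
proof (rule sum_atMost_1_4)
    fix s :: nat assume s: "s \<in> {1..4}" "s > m"
    then consider "s = m + 1" | "s = m + 2" | "s = m + 3" | "s = m + 4" by force
    then show "((of_nat m - of_nat s + 1) * (of_nat m - of_nat s + 2)
        * (of_nat m - of_nat s + 3) * (of_nat m - of_nat s + 4) / 24 :: rat) = 0"
      by cases simp_all
  next
    fix s assume "s \<le> m"
    then show "of_nat ((m - s + 4) choose 4) = ((of_nat m - of_nat s + 1)
        * (of_nat m - of_nat s + 2) * (of_nat m - of_nat s + 3) * (of_nat m - of_nat s + 4) / 24 :: rat)"
      unfolding of_nat_choose_4 by (simp add: of_nat_diff)
  qed (rule T_eq_0[OF q0])

text \<open>Multiplication by 1 - x^q takes differences of coefficients \<open>q\<close> apart, and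
  1/(c + q) is congruent to 1/c modulo \<open>q\<close>.\<close>

lemma recip_fps_first_order:
  assumes r: "r > 0" and q: "q = p ^ r"
  shows "fps_pcong r (recip_fps p * (1 - fps_X ^ q)) (trunc q)"
  unfolding fps_pcong_def
proof
  fix l
  have q0: "q > 0" using q by simp
  have "p dvd q" using r q by (simp add: dvd_power)
  then have cop: "coprime (c + q) p \<longleftrightarrow> coprime c p" for c
    by (simp add: coprime_p_iff dvd_add_left_iff)
  show "pcong r ((recip_fps p * (1 - fps_X ^ q)) $ l) (trunc q $ l)"
  proof (cases "l < q")
    case True
    then show ?thesis unfolding mult_one_minus_X_power_nth by (simp add: recip_fps_nth trunc_nth)
  next
    case False
    then obtain c where l: "l = c + q" by (metis add.commute le_Suc_ex not_less)
    show ?thesis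
    proof (cases "coprime c p")
      case True
      have "1 / of_nat (c + q) - 1 / of_nat c
          = of_nat q * (- (1 / of_nat (c + q)) * (1 / of_nat c) :: rat)"
        using q0 coprime_p_pos[OF True] by (simp add: field_simps add_eq_0_iff)
      moreover have "of_nat q * (- (1 / of_nat (c + q)) * (1 / of_nat c) :: rat) \<in> pideal r"
        using True cop q by (intro pideal_mult_right local_mult local_uminus local_inverse)
          simp_all
      ultimately show ?thesis unfolding mult_one_minus_X_power_nth l pcong_def
        using True by (simp add: recip_fps_nth trunc_nth cop)
    next
      case False
      then show ?thesis unfolding mult_one_minus_X_power_nth l by (simp add: recip_fps_nth trunc_nth cop)
    qed
  qed
qed

lemma recip_fps_local [intro, simp]: "fps_local (recip_fps p)"
  unfolding fps_local_def recip_fps_nth by auto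

text \<open>The fifth power equals \<open>(recip_fps p * (1 - fps_X ^ q)) ^ 5\<close> times the
  series of (1 - x^q)^(-5); the base is replaced by \<open>trunc q\<close> and the coefficient at
  \<open>q * m\<close> is read off.\<close>

lemma recip_sum5_pcong_T:
  assumes r: "r > 0" and q: "q = p ^ r"
  shows "pcong r (recip_sum5 p (q * m))
    (\<Sum>s=1..4. T q s * ((of_nat m - of_nat s + 1) * (of_nat m - of_nat s + 2)
        * (of_nat m - of_nat s + 3) * (of_nat m - of_nat s + 4) / 24))"
proof -
  have q0: "q > 0" using q by simp
  have "recip_fps p ^ 5 = recip_fps p ^ 5 * (geometric_power q 4 * (1 - fps_X ^ q) ^ Suc 4)"
    by (simp only: geometric_power_mult[OF q0] mult_1_right)
  also have "\<dots> = (recip_fps p * (1 - fps_X ^ q)) ^ 5 * geometric_power q 4"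
    by (simp add: power_mult_distrib mult_ac)
  finally have L: "recip_fps p ^ 5 = (recip_fps p * (1 - fps_X ^ q)) ^ 5 * geometric_power q 4" .
  have "fps_pcong r (recip_fps p ^ 5) (trunc q ^ 5 * geometric_power q 4)"
    unfolding L
    by (intro fps_pcong_mult fps_pcong_power recip_fps_first_order r q fps_pcong_refl
        fps_local_power trunc_local geometric_power_local)
  then have "pcong r (recip_sum5 p (q * m)) ((trunc q ^ 5 * geometric_power q 4) $ (q * m))"
    using prime_p by (simp add: fps_pcong_def recip_sum5_eq_nth)
  also have "(trunc q ^ 5 * geometric_power q 4) $ (q * m) =
      (\<Sum>s\<le>m. T q s * of_nat ((m - s + 4) choose 4))"
    by (simp add: fps_mult_geometric_power_nth[OF q0] T_def)
  also have "\<dots> = (\<Sum>s=1..4. T q s * ((of_nat m - of_nat s + 1) * (of_nat m - of_nat s + 2)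
        * (of_nat m - of_nat s + 3) * (of_nat m - of_nat s + 4) / 24))"
    by (rule sum_T_choose_4[OF q0])
  finally show ?thesis .
qed

lemma fps_pcong_of_diff:
  assumes "F - G = fps_const z * K" "z \<in> pideal k" "fps_local K"
  shows "fps_pcong k F G"
  unfolding fps_pcong_def pcong_def fps_sub_nth[symmetric] assms(1)
  using assms(2,3) by (auto simp: fps_local_def intro: pideal_mult_right)

section \<open>The second-order expansion of the reciprocal series\<close>

definition trunc2 :: "nat \<Rightarrow> rat fps" where
  "trunc2 q = monomial_sum (units q) (\<lambda>b. 1 / of_nat b ^ 2)"

lemma trunc2_nth: "trunc2 q $ l = (if l < q \<and> coprime l p then 1 / of_nat l ^ 2 else 0)"
  by (simp add: trunc2_def monomial_sum_nth)

lemma local_inverse_power [simp, intro]: "coprime n p \<Longrightarrow> 1 / of_nat n ^ k \<in> Z"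
  using local_power[OF local_inverse[of n], of k] by (simp add: power_one_over)

lemma trunc2_local [intro, simp]: "fps_local (trunc2 q)"
  unfolding fps_local_def trunc2_nth by auto

lemma trunc2_nonzero: "trunc2 q $ i \<noteq> 0 \<Longrightarrow> 1 \<le> i \<and> i \<le> q - 1"
  by (auto simp: trunc2_nth dest: coprime_p_pos split: if_splits)

text \<open>The left side takes second differences with step \<open>q\<close>. From the third period
  on, those of 1/l are divisible by q^2; on the second period, 1/(b + q) is 1/b - q/b^2 modulo q^2,
  which leaves the correction \<open>trunc2 q\<close>.\<close>

lemma recip_fps_second_order:
  assumes r: "r > 0" and q: "q = p ^ r"
  shows "fps_pcong (2 * r) (recip_fps p * (1 - fps_X ^ q) ^ 2)
    (trunc q * (1 - fps_X ^ q) - fps_const (of_nat q) * (fps_X ^ q * trunc2 q))"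
  unfolding fps_pcong_def
proof
  fix l
  have q0: "q > 0" using q by simp
  have "p dvd q" using r q by (simp add: dvd_power)
  then have cop: "coprime (c + q) p \<longleftrightarrow> coprime c p" for c
    by (simp add: coprime_p_iff dvd_add_left_iff)
  have q2: "of_nat q ^ 2 = (of_nat p ^ (2 * r) :: rat)" using q by (simp add: power_mult mult.commute)
  have L: "(recip_fps p * (1 - fps_X ^ q) ^ 2) $ l =
     recip_fps p $ l - (if l < q then 0 else recip_fps p $ (l - q))
      - (if l < q then 0 else recip_fps p $ (l - q) -
          (if l - q < q then 0 else recip_fps p $ (l - q - q)))"
    by (simp add: power2_eq_square mult_one_minus_X_power_nth flip: mult.assoc)
  have R: "(trunc q * (1 - fps_X ^ q) - fps_const (of_nat q) * (fps_X ^ q * trunc2 q)) $ l =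
     trunc q $ l - (if l < q then 0 else trunc q $ (l - q))
      - of_nat q * (if l < q then 0 else trunc2 q $ (l - q))"
    by (simp add: mult_one_minus_X_power_nth fps_X_power_mult_nth)
  have key: "pcong (2 * r) x y"
    if "x - y = of_nat q ^ 2 * z" "z \<in> Z" for x y z
    unfolding pcong_def that(1) q2 by (rule pideal_mult_right[OF pideal_p_power that(2)])
  consider "l < q" | b where "l = b + q" "b < q" | c where "l = c + q + q"
    by (metis add.commute le_Suc_ex not_less)
  then show "pcong (2 * r) ((recip_fps p * (1 - fps_X ^ q) ^ 2) $ l)
    ((trunc q * (1 - fps_X ^ q) - fps_const (of_nat q) * (fps_X ^ q * trunc2 q)) $ l)"
  proof cases
    case 1
    then show ?thesis unfolding L R by (simp add: recip_fps_nth trunc_nth)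
  next
    case 2
    show ?thesis
    proof (cases "coprime b p")
      case True
      have "(1 / of_nat (b + q) - 1 / of_nat b - 1 / of_nat b) -
             (- 1 / of_nat b - of_nat q * (1 / of_nat b ^ 2)) =
          (of_nat q ^ 2 * ((1 / of_nat b ^ 2) * (1 / of_nat (b + q))) :: rat)"
        using q0 coprime_p_pos[OF True]
        by (simp add: divide_simps add_eq_0_iff) (simp add: algebra_simps power2_eq_square)
      then have "pcong (2 * r) (1 / of_nat (b + q) - 1 / of_nat b - 1 / of_nat b)
         (- 1 / of_nat b - of_nat q * (1 / of_nat b ^ 2))"
        by (rule key) (use True cop in \<open>intro local_mult local_inverse local_inverse_power; simp\<close>)
      then show ?thesis unfolding L R unfolding 2(1)
        using True 2 by (simp add: recip_fps_nth trunc_nth trunc2_nth cop)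
    next
      case False
      then show ?thesis unfolding L R unfolding 2(1)
        using 2 by (simp add: recip_fps_nth trunc_nth trunc2_nth cop)
    qed
  next
    case 3
    show ?thesis
    proof (cases "coprime c p")
      case True
      have "(1 / of_nat (c + q + q) - 1 / of_nat (c + q) - (1 / of_nat (c + q) - 1 / of_nat c)) - 0 =
          (of_nat q ^ 2 * (2 * (1 / of_nat c) * (1 / of_nat (c + q)) * (1 / of_nat (c + q + q))) :: rat)"
        using q0 coprime_p_pos[OF True]
        by (simp add: divide_simps add_eq_0_iff) (simp add: algebra_simps power2_eq_square)
      then have "pcong (2 * r) (1 / of_nat (c + q + q) - 1 / of_nat (c + q)
          - (1 / of_nat (c + q) - 1 / of_nat c)) 0"
        by (rule key) (use True cop in \<open>intro local_mult local_inverse local_numeral; simp\<close>)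
      then show ?thesis unfolding L R unfolding 3
        using True by (simp add: recip_fps_nth trunc_nth trunc2_nth cop)
    next
      case False
      then show ?thesis unfolding L R unfolding 3
        by (simp add: recip_fps_nth trunc_nth trunc2_nth cop)
    qed
  qed
qed

text \<open>
  The correction term of the second-order expansion contributes only binomial coefficients
  $\binom{p - s + 4}{5}$ with $1 \le s \le 4$, all divisible by \<open>p\<close>; so one more
  power of \<open>p\<close> is gained at \<open>m = p\<close>.
\<close>

lemma recip_sum5_pcong_T_p:
  assumes r: "r > 0" and q: "q = p ^ r"
  shows "pcong (r + 1) (recip_sum5 p (q * p))
    (\<Sum>s=1..4. T q s * ((of_nat p - of_nat s + 1) * (of_nat p - of_nat s + 2)
        * (of_nat p - of_nat s + 3) * (of_nat p - of_nat s + 4) / 24))"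
proof -
  have q0: "q > 0" using q by simp
  define f where "f = trunc q"
  define h where "h = fps_X ^ q * trunc2 q"
  define y where "y = (1 - fps_X ^ q :: rat fps)"
  define W where "W = geometric_power q"
  define Q where "Q = fps_const (of_nat q :: rat)"
  have loc: "fps_local f" "fps_local h" "fps_local y" "fps_local (W k)" "fps_local Q" for k
    unfolding f_def h_def y_def W_def Q_def by auto
  have loc5: "fps_local (of_nat n)" for n
    using fps_local_basic(3)[OF local_of_nat[of n]] by (simp add: fps_of_nat)
  \<comment> \<open>Each of the five bases takes two factors \<open>y\<close>, so ten are inserted;
    \<open>W 9\<close> is the inverse of \<open>y ^ 10\<close>.\<close>
  have "recip_fps p ^ 5 = recip_fps p ^ 5 * (W 9 * y ^ Suc 9)"
    by (simp only: W_def y_def geometric_power_mult[OF q0] mult_1_right)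
  also have "\<dots> = (recip_fps p * y ^ 2) ^ 5 * W 9"
    by (simp add: power_mult_distrib mult_ac flip: power_mult)
  finally have L: "recip_fps p ^ 5 = (recip_fps p * y ^ 2) ^ 5 * W 9" .
  have "fps_pcong (2 * r) (recip_fps p ^ 5) ((f * y - Q * h) ^ 5 * W 9)"
    unfolding L
    by (intro fps_pcong_mult fps_pcong_power fps_pcong_refl fps_local_power loc
        fps_local_diff fps_local_mult)
      (simp_all add: recip_fps_local recip_fps_second_order[OF r q] f_def h_def y_def Q_def)
  also have "fps_pcong (2 * r) ((f * y - Q * h) ^ 5 * W 9)
     ((f ^ 5 * y ^ 5 - of_nat 5 * Q * h * f ^ 4 * y ^ 4) * W 9)"
  proof (rule fps_pcong_of_diff)
    \<comment> \<open>Binomial expansion, with all terms of degree at least two in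
      \<open>Q * h\<close> collected. The inner \<open>0 - (Q * h) ^ 2\<close> turns an addition
      into subtractions, to which \<open>fps_local_diff\<close> applies.\<close>
    have "(f * y - Q * h) ^ 5 * W 9 - (f ^ 5 * y ^ 5 - of_nat 5 * Q * h * f ^ 4 * y ^ 4) * W 9 =
       (Q * Q) * (h ^ 2 * (of_nat 10 * (f * y) ^ 3 - of_nat 10 * (f * y) ^ 2 * (Q * h)
          - (Q * h) ^ 3 - of_nat 5 * (f * y) * (0 - (Q * h) ^ 2)) * W 9)"
      by (simp add: eval_nat_numeral algebra_simps)
    also have "Q * Q = fps_const (of_nat p ^ (2 * r))"
      by (simp add: Q_def q power_mult_distrib mult_2 power_add)
    finally show "(f * y - Q * h) ^ 5 * W 9 -
        (f ^ 5 * y ^ 5 - of_nat 5 * Q * h * f ^ 4 * y ^ 4) * W 9 =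
       fps_const (of_nat p ^ (2 * r)) * (h ^ 2 * (of_nat 10 * (f * y) ^ 3
          - of_nat 10 * (f * y) ^ 2 * (Q * h)
          - (Q * h) ^ 3 - of_nat 5 * (f * y) * (0 - (Q * h) ^ 2)) * W 9)" .
    show "fps_local (h ^ 2 * (of_nat 10 * (f * y) ^ 3
          - of_nat 10 * (f * y) ^ 2 * (Q * h)
          - (Q * h) ^ 3 - of_nat 5 * (f * y) * (0 - (Q * h) ^ 2)) * W 9)"
      using loc5[of 0] by (intro fps_local_mult fps_local_diff fps_local_power loc loc5) simp
  qed simp
  also have "(f ^ 5 * y ^ 5 - of_nat 5 * Q * h * f ^ 4 * y ^ 4) * W 9 =
      f ^ 5 * W 4 - of_nat 5 * Q * (fps_X ^ q * (trunc2 q * f ^ 4 * W 5))"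
  proof -
    have "y ^ 5 * W 9 = W 4" "y ^ 4 * W 9 = W 5"
      using geometric_power_cancel[OF q0, of 5 4] geometric_power_cancel[OF q0, of 4 5]
      by (simp_all add: y_def W_def)
    moreover have "(f ^ 5 * y ^ 5 - of_nat 5 * Q * h * f ^ 4 * y ^ 4) * W 9 =
        f ^ 5 * (y ^ 5 * W 9) - of_nat 5 * Q * h * f ^ 4 * (y ^ 4 * W 9)"
      by (simp add: algebra_simps)
    ultimately show ?thesis by (simp add: h_def mult_ac)
  qed
  finally have "pcong (2 * r) (recip_sum5 p (q * p))
    ((f ^ 5 * W 4 - of_nat 5 * Q * (fps_X ^ q * (trunc2 q * f ^ 4 * W 5))) $ (q * p))"
    using prime_p by (simp add: fps_pcong_def recip_sum5_eq_nth)
  then have "pcong (r + 1) (recip_sum5 p (q * p))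
    ((f ^ 5 * W 4 - of_nat 5 * Q * (fps_X ^ q * (trunc2 q * f ^ 4 * W 5))) $ (q * p))"
    by (rule pcong_mono) (use r in simp)
  also have "(f ^ 5 * W 4 - of_nat 5 * Q * (fps_X ^ q * (trunc2 q * f ^ 4 * W 5))) $ (q * p) =
     (f ^ 5 * W 4) $ (q * p) - 5 * (of_nat q * (trunc2 q * f ^ 4 * W 5) $ (q * (p - 1)))"
  proof -
    have "of_nat 5 * Q = fps_const (5 * of_nat q)"
      by (simp add: Q_def numeral_fps_const flip: fps_const_mult)
    then have "(of_nat 5 * Q * (fps_X ^ q * (trunc2 q * f ^ 4 * W 5))) $ (q * p) =
        5 * of_nat q * (fps_X ^ q * (trunc2 q * f ^ 4 * W 5)) $ (q * p)"
      by (simp only: fps_mult_left_const_nth)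
    then show ?thesis by (simp add: fps_X_power_mult_nth diff_mult_distrib2)
  qed
  also have "pcong (r + 1) \<dots> ((f ^ 5 * W 4) $ (q * p) - 0)"
  proof (rule pcong_diff)
    have "(trunc2 q * f ^ 4 * W 5) $ (q * (p - 1)) =
        (\<Sum>s\<le>p - 1. (trunc2 q * f ^ 4) $ (q * s) * of_nat ((p - 1 - s + 5) choose 5))"
      unfolding W_def by (rule fps_mult_geometric_power_nth[OF q0])
    also have "\<dots> \<in> pideal 1"
    proof (rule pideal_sum)
      fix s assume "s \<in> {..p - 1}"
      then have s: "s \<le> p - 1" by simp
      show "(trunc2 q * f ^ 4) $ (q * s) * of_nat ((p - 1 - s + 5) choose 5) \<in> pideal 1"
      proof (cases "s \<in> {1..4}")
        case True
        then consider "s = 1" | "s = 2" | "s = 3" | "s = 4" by force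
        \<comment> \<open>120 times the binomial coefficient is the product of five consecutive
          integers from p - s on, one of which is \<open>p\<close>; the witness is the product of
          the other four.\<close>
        then have "\<exists>z\<in>Z. of_nat 120 * of_nat ((p - 1 - s + 5) choose 5) = of_nat p * (z :: rat)"
        proof cases
          case 1
          then show ?thesis using p_gt_5 unfolding of_nat_choose_5
            by (intro bexI[of _ "(of_nat p - 1) * (of_nat p + 1) * (of_nat p + 2) * (of_nat p + 3)"])
               (auto simp: of_nat_diff add.commute)
        next
          case 2
          then show ?thesis using p_gt_5 unfolding of_nat_choose_5
            by (intro bexI[of _ "(of_nat p - 2) * (of_nat p - 1) * (of_nat p + 1) * (of_nat p + 2)"])
               (auto simp: of_nat_diff add.commute)
        next
          case 3
          then show ?thesis using p_gt_5 unfolding of_nat_choose_5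
            by (intro bexI[of _ "(of_nat p - 3) * (of_nat p - 2) * (of_nat p - 1) * (of_nat p + 1)"])
               (auto simp: of_nat_diff add.commute)
        next
          case 4
          then show ?thesis using p_gt_5 unfolding of_nat_choose_5
            by (intro bexI[of _ "(of_nat p - 4) * (of_nat p - 3) * (of_nat p - 2) * (of_nat p - 1)"])
               (auto simp: of_nat_diff add.commute)
        qed
        then have "of_nat 120 * of_nat ((p - 1 - s + 5) choose 5) \<in> pideal 1"
          using pideal_mult_right[OF pideal_p] by fastforce
        moreover have "coprime 120 p"
          using coprime_p_fact[of 5] p_gt_5 by (simp add: fact_numeral)
        ultimately have "of_nat ((p - 1 - s + 5) choose 5) \<in> pideal 1"
          by (simp only: pideal_cancel_unit)
        moreover have "fps_local (trunc2 q * f ^ 4)"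
          by (intro fps_local_mult fps_local_power loc trunc2_local)
        ultimately show ?thesis by (intro pideal_mult_left) (simp_all add: fps_local_def)
      next
        case False
        have "5 \<le> n \<and> n \<le> 5 * (q - 1)" if "(trunc2 q * f ^ 4) $ n \<noteq> 0" for n
          using fps_mult_nth_eq_0[of "trunc2 q" 1 "q - 1" "f ^ 4" 4 "4 * (q - 1)" n]
            trunc2_nonzero[of q] fps_power_nth_eq_0[of f 1 "q - 1" 4] trunc_nonzero[of q] that
          by (simp add: f_def)
        from nth_eq_0_outside[OF q0 this False] show ?thesis by simp
      qed
    qed
    finally have "(trunc2 q * f ^ 4 * W 5) $ (q * (p - 1)) \<in> pideal 1" .
    then have "of_nat q * (trunc2 q * f ^ 4 * W 5) $ (q * (p - 1)) \<in> pideal (r + 1)"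
      by (intro pideal_mult[of _ r _ 1]) (simp_all add: q)
    then show "pcong (r + 1) (5 * (of_nat q * (trunc2 q * f ^ 4 * W 5) $ (q * (p - 1)))) 0"
      unfolding pcong_0_iff by (rule pideal_mult_left[rotated]) simp
  qed simp
  also have "(f ^ 5 * W 4) $ (q * p) - 0 = (\<Sum>s\<le>p. T q s * of_nat ((p - s + 4) choose 4))"
    by (simp add: fps_mult_geometric_power_nth[OF q0] T_def f_def W_def)
  also have "\<dots> = (\<Sum>s=1..4. T q s * ((of_nat p - of_nat s + 1) * (of_nat p - of_nat s + 2)
        * (of_nat p - of_nat s + 3) * (of_nat p - of_nat s + 4) / 24))"
    by (rule sum_T_choose_4[OF q0])
  finally show ?thesis .
qed

lemma T_nested:
  "T q s = (\<Sum>a\<in>units q. \<Sum>b\<in>units q. \<Sum>c\<in>units q. \<Sum>d\<in>units q. \<Sum>e\<in>units q.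
      if a + b + c + d + e = q * s
      then 1 / of_nat a * (1 / of_nat b) * (1 / of_nat c) * (1 / of_nat d) * (1 / of_nat e)
      else 0)"
  unfolding T_def trunc_def monomial_sum_prod5_nth[symmetric]
  by (simp add: eval_nat_numeral mult.assoc)

end

lemma sum_lessThan_mult:
  fixes g :: "nat \<Rightarrow> 'a :: comm_monoid_add"
  shows "(\<Sum>x<n * m. g x) = (\<Sum>i<n. \<Sum>j<m. g (i * m + j))"
proof -
  have "sum g {a..<a + m} = (\<Sum>j<m. g (a + j))" for a
    by (induction m) simp_all
  then show ?thesis by (simp flip: sum.nat_group)
qed

text \<open>\<open>sum.swap\<close> loops as a rewrite rule, so each of the five exchanges is fixed
  as an equation that moves the sum over \<open>S\<close> one place inwards.\<close>

lemma sum_swap_nested5: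
  fixes \<phi> :: "'s \<Rightarrow> nat \<Rightarrow> nat \<Rightarrow> nat \<Rightarrow> nat \<Rightarrow> nat \<Rightarrow> rat"
  shows "(\<Sum>s\<in>S. \<Sum>a\<in>A. \<Sum>b\<in>A. \<Sum>c\<in>A. \<Sum>d\<in>A. \<Sum>e\<in>A. \<phi> s a b c d e) =
    (\<Sum>a\<in>A. \<Sum>b\<in>A. \<Sum>c\<in>A. \<Sum>d\<in>A. \<Sum>e\<in>A. \<Sum>s\<in>S. \<phi> s a b c d e)"
proof -
  have w1: "(\<Sum>s\<in>S. \<Sum>a\<in>A. \<Sum>b\<in>A. \<Sum>c\<in>A. \<Sum>d\<in>A. \<Sum>e\<in>A. \<phi> s a b c d e) = (\<Sum>a\<in>A. \<Sum>s\<in>S. \<Sum>b\<in>A. \<Sum>c\<in>A. \<Sum>d\<in>A. \<Sum>e\<in>A. \<phi> s a b c d e)"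
    by (rule sum.swap)
  have w2: "(\<Sum>s\<in>S. \<Sum>b\<in>A. \<Sum>c\<in>A. \<Sum>d\<in>A. \<Sum>e\<in>A. \<phi> s a b c d e) = (\<Sum>b\<in>A. \<Sum>s\<in>S. \<Sum>c\<in>A. \<Sum>d\<in>A. \<Sum>e\<in>A. \<phi> s a b c d e)" for a
    by (rule sum.swap)
  have w3: "(\<Sum>s\<in>S. \<Sum>c\<in>A. \<Sum>d\<in>A. \<Sum>e\<in>A. \<phi> s a b c d e) = (\<Sum>c\<in>A. \<Sum>s\<in>S. \<Sum>d\<in>A. \<Sum>e\<in>A. \<phi> s a b c d e)" for a b
    by (rule sum.swap)
  have w4: "(\<Sum>s\<in>S. \<Sum>d\<in>A. \<Sum>e\<in>A. \<phi> s a b c d e) = (\<Sum>d\<in>A. \<Sum>s\<in>S. \<Sum>e\<in>A. \<phi> s a b c d e)" for a b c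
    by (rule sum.swap)
  have w5: "(\<Sum>s\<in>S. \<Sum>e\<in>A. \<phi> s a b c d e) = (\<Sum>e\<in>A. \<Sum>s\<in>S. \<phi> s a b c d e)" for a b c d
    by (rule sum.swap)
  show ?thesis by (simp only: w1 w2 w3 w4 w5)
qed

context prime_gt_5
begin

text \<open>The substitution $b \mapsto q - b$ in each of the five variables.\<close>

lemma T_symmetric:
  assumes r: "r > 0" and q: "q = p ^ r" and s: "s \<le> 5"
  shows "pcong r (T q (5 - s)) (- T q s)"
proof -
  have "p dvd q" using r q by (simp add: dvd_power)
  then have cop: "coprime (q - b) p" if "coprime b p" "b < q" for b
    using that \<open>p dvd q\<close> dvd_diffD[of p q b] dvd_diff_nat[of p q "q - b"]
    by (auto simp: coprime_p_iff)
  have reflect: "sum \<phi> (units q) = (\<Sum>b\<in>units q. \<phi> (q - b))" for \<phi> :: "nat \<Rightarrow> rat"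
    by (rule sum.reindex_bij_witness[of _ "\<lambda>b. q - b" "\<lambda>b. q - b"])
      (use cop in \<open>auto dest: coprime_p_pos\<close>)
  have inv: "pcong r (1 / of_nat (q - b)) (- (1 / of_nat b))" if "b \<in> units q" for b
  proof -
    have b: "coprime b p" "b < q" "0 < b" using that by (auto dest: coprime_p_pos)
    have "1 / of_nat (q - b) - (- (1 / of_nat b)) =
        (of_nat p ^ r * ((1 / of_nat (q - b)) * (1 / of_nat b)) :: rat)"
      using b q by (simp add: of_nat_diff field_simps)
    also have "\<dots> \<in> pideal r"
      by (intro pideal_mult_right pideal_p_power local_mult local_inverse b cop)
    finally show ?thesis by (simp add: pcong_def)
  qed
  define \<phi> where "\<phi> t a b c d e = (if a + b + c + d + e = q * t
      then 1 / of_nat a * (1 / of_nat b) * (1 / of_nat c) * (1 / of_nat d) * (1 / of_nat e)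
      else (0 :: rat))" for t a b c d e :: nat
  have r5: "(\<Sum>e\<in>units q. \<phi> t a b c d e) =
      (\<Sum>e\<in>units q. \<phi> t a b c d (q - e))" for t a b c d
    by (rule reflect)
  have r4: "(\<Sum>d\<in>units q. \<Sum>e\<in>units q. \<phi> t a b c d (q - e)) =
      (\<Sum>d\<in>units q. \<Sum>e\<in>units q. \<phi> t a b c (q - d) (q - e))" for t a b c
    by (rule reflect)
  have r3: "(\<Sum>c\<in>units q. \<Sum>d\<in>units q. \<Sum>e\<in>units q. \<phi> t a b c (q - d) (q - e)) =
      (\<Sum>c\<in>units q. \<Sum>d\<in>units q. \<Sum>e\<in>units q. \<phi> t a b (q - c) (q - d) (q - e))" for t a b
    by (rule reflect)
  have r2: "(\<Sum>b\<in>units q. \<Sum>c\<in>units q. \<Sum>d\<in>units q. \<Sum>e\<in>units q. \<phi> t a b (q - c) (q - d) (q - e)) =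
      (\<Sum>b\<in>units q. \<Sum>c\<in>units q. \<Sum>d\<in>units q. \<Sum>e\<in>units q. \<phi> t a (q - b) (q - c) (q - d) (q - e))" for t a
    by (rule reflect)
  have r1: "(\<Sum>a\<in>units q. \<Sum>b\<in>units q. \<Sum>c\<in>units q. \<Sum>d\<in>units q. \<Sum>e\<in>units q. \<phi> t a (q - b) (q - c) (q - d) (q - e)) =
      (\<Sum>a\<in>units q. \<Sum>b\<in>units q. \<Sum>c\<in>units q. \<Sum>d\<in>units q. \<Sum>e\<in>units q. \<phi> t (q - a) (q - b) (q - c) (q - d) (q - e))" for t 
    by (rule reflect)
  have T1: "T q (5 - s) = (\<Sum>a\<in>units q. \<Sum>b\<in>units q. \<Sum>c\<in>units q. \<Sum>d\<in>units q. \<Sum>e\<in>units q.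
      \<phi> (5 - s) (q - a) (q - b) (q - c) (q - d) (q - e))"
    unfolding T_nested \<phi>_def[symmetric] by (simp only: r5 r4 r3 r2 r1)
  have "pcong r (T q (5 - s)) (\<Sum>a\<in>units q. \<Sum>b\<in>units q. \<Sum>c\<in>units q. \<Sum>d\<in>units q. \<Sum>e\<in>units q.
      - \<phi> s a b c d e)"
    unfolding T1
  proof (intro pcong_sum)
    fix a b c d e
    assume u: "a \<in> units q" "b \<in> units q" "c \<in> units q" "d \<in> units q" "e \<in> units q"
    then have le: "a \<le> q" "b \<le> q" "c \<le> q" "d \<le> q" "e \<le> q" by auto
    \<comment> \<open>Reflecting all five variables turns a total N into 5q - N, so level
      \<open>s\<close> becomes level \<open>5 - s\<close>; five sign changes give the minus.\<close>
    have qs: "q * (5 - s) + q * s = 5 * q"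
      using s by (simp flip: distrib_left)
    have "a' + b' + c' + d' + e' = q * (5 - s) \<longleftrightarrow> a + b + c + d + e = q * s"
      if "a + a' = q" "b + b' = q" "c + c' = q" "d + d' = q" "e + e' = q" for a' b' c' d' e'
      using that qs by linarith
    then have "(q - a) + (q - b) + (q - c) + (q - d) + (q - e) = q * (5 - s) \<longleftrightarrow>
        a + b + c + d + e = q * s"
      using le by (metis le_add_diff_inverse)
    moreover have "pcong r (1 / of_nat (q - a) * (1 / of_nat (q - b)) * (1 / of_nat (q - c))
          * (1 / of_nat (q - d)) * (1 / of_nat (q - e)))
        (- (1 / of_nat a) * - (1 / of_nat b) * - (1 / of_nat c) * - (1 / of_nat d) * - (1 / of_nat e))"
      using u by (intro pcong_mult inv local_mult local_uminus local_inverse cop) auto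
    ultimately show "pcong r (\<phi> (5 - s) (q - a) (q - b) (q - c) (q - d) (q - e)) (- \<phi> s a b c d e)"
      by (simp add: \<phi>_def)
  qed
  moreover have "(\<Sum>a\<in>units q. \<Sum>b\<in>units q. \<Sum>c\<in>units q. \<Sum>d\<in>units q. \<Sum>e\<in>units q.
      - \<phi> s a b c d e) = - T q s"
    unfolding T_nested \<phi>_def[symmetric] by (simp only: sum_negf)
  ultimately show ?thesis by (simp only:)
qed

subsection \<open>Higher powers of \<open>p\<close>\<close>

text \<open>Exactly one residue \<open>e\<close> modulo \<open>q\<close> satisfies v + e = 0, and it
  is prime to \<open>p\<close> precisely when \<open>v\<close> is.\<close>

lemma sum_units_complement:
  fixes t :: rat
  assumes r: "r > 0" and q: "q = p ^ r"
  shows "(\<Sum>e\<in>units q. if q dvd v + e then t else 0) = t * (if p dvd v then 0 else 1)"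
proof -
  have pq: "p dvd q" using r q by (simp add: dvd_power)
  have q0: "q > 0" using q by simp
  show ?thesis
  proof (cases "p dvd v")
    case True
    have "\<not> q dvd v + e" if "coprime e p" for e
      using that True pq by (metis coprime_p_iff dvd_add_right_iff dvd_trans)
    then have "(\<Sum>e\<in>units q. if q dvd v + e then t else 0) = 0"
      by (intro sum.neutral) auto
    then show ?thesis using True by simp
  next
    case False
    define e0 where "e0 = q - v mod q"
    have "\<not> q dvd v" using False pq dvd_trans by blast
    then have vq: "0 < v mod q" "v mod q < q" using q0 by (auto simp: dvd_eq_mod_eq_0)
    have "v + e0 = q * (v div q) + q"
      using vq mult_div_mod_eq[of q v] unfolding e0_def by linarith
    then have dvd0: "q dvd v + e0" by simp
    then have "p dvd v + e0" using pq dvd_trans by blast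
    then have "coprime e0 p" using False by (auto simp: coprime_p_iff dvd_add_left_iff)
    then have mem: "e0 \<in> units q" using vq by (simp add: e0_def)
    have "e = e0" if "e \<in> units q" "q dvd v + e" for e
    proof -
      have "[v + e = v + e0] (mod q)"
        using that dvd0 by (simp add: cong_def dvd_eq_mod_eq_0)
      then have "[e = e0] (mod q)" by (simp add: cong_add_lcancel_nat)
      then show ?thesis using that mem by (auto simp: cong_def)
    qed
    then have "q dvd v + e \<longleftrightarrow> e = e0" if "e \<in> units q" for e
      using that dvd0 by blast
    then have "(\<Sum>e\<in>units q. if q dvd v + e then t else 0) = (\<Sum>e\<in>units q. if e = e0 then t else 0)"
      by (intro sum.cong refl if_cong)
    also have "\<dots> = t" using mem by (subst sum.delta) simp_all
    finally show ?thesis using False by simp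
  qed
qed

text \<open>Unfolded, this is the sum of 1/(a_1 ... a_k) over units a_i for which v + a_1 + ... +
  a_k is prime to \<open>p\<close>. The recursive form allows each variable to be treated in
  turn.\<close>

primrec residue_sum :: "nat \<Rightarrow> nat \<Rightarrow> nat \<Rightarrow> rat" where
  "residue_sum q 0 v = (if p dvd v then 0 else 1)"
| "residue_sum q (Suc k) v = (\<Sum>a\<in>units q. 1 / of_nat a * residue_sum q k (v + a))"

lemma residue_sum_periodic: "residue_sum q k (v + j * p) = residue_sum q k v"
proof (induction k arbitrary: v)
  case 0
  show ?case by (simp add: dvd_add_left_iff)
next
  case (Suc k)
  have "residue_sum q k (v + j * p + a) = residue_sum q k (v + a)" for a
    using Suc[of "v + a"] by (simp add: add_ac)
  then show ?case by simp
qed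

text \<open>Cut a range of p^(k+1) indices into \<open>p\<close> blocks of length p^k. The block
  sums agree modulo p^(k+1), so the total is \<open>p\<close> times one of them, which p^k divides
  by induction.\<close>

lemma sum_inverse_residue_class:
  assumes "coprime c p"
  shows "(\<Sum>j<p ^ k. 1 / of_nat (j * p + c)) \<in> pideal k"
proof (induction k)
  case 0
  then show ?case using assms by simp
next
  case (Suc k)
  have cop: "coprime (j * p + c) p" for j
    using assms by (simp add: coprime_p_iff dvd_add_right_iff)
  let ?h = "\<lambda>j. 1 / of_nat (j * p + c) :: rat"
  have "pcong (Suc k) (\<Sum>i<p. \<Sum>j<p ^ k. ?h (i * p ^ k + j)) (\<Sum>i<p. \<Sum>j<p ^ k. ?h j)"
  proof (intro pcong_sum)
    fix i j
    have "?h (i * p ^ k + j) - ?h j =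
        of_nat p ^ Suc k * (- of_nat i * (?h (i * p ^ k + j) * ?h j))"
      using coprime_p_pos[OF cop[of j]] coprime_p_pos[OF cop[of "i * p ^ k + j"]]
      by (simp add: field_simps del: of_nat_add of_nat_mult of_nat_power)
         (simp add: algebra_simps)
    also have "\<dots> \<in> pideal (Suc k)"
      by (intro pideal_mult_right pideal_p_power local_mult local_uminus local_of_nat
          local_inverse cop)
    finally show "pcong (Suc k) (?h (i * p ^ k + j)) (?h j)" by (simp add: pcong_def)
  qed
  moreover have "(\<Sum>i<p. \<Sum>j<p ^ k. ?h j) \<in> pideal (Suc k)"
    using pideal_mult[OF pideal_p Suc] by simp
  ultimately have "(\<Sum>i<p. \<Sum>j<p ^ k. ?h (i * p ^ k + j)) \<in> pideal (Suc k)"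
    unfolding pcong_def using pideal_add by fastforce
  then show ?case by (simp only: power_Suc sum_lessThan_mult)
qed

lemma sum_units_split:
  fixes \<phi> :: "nat \<Rightarrow> rat"
  shows "(\<Sum>a\<in>units (p ^ Suc k). \<phi> a) = (\<Sum>c\<in>{1..<p}. \<Sum>j<p ^ k. \<phi> (j * p + c))"
proof -
  have "(\<Sum>a\<in>units (p ^ Suc k). \<phi> a) = (\<Sum>a<p ^ k * p. if coprime a p then \<phi> a else 0)"
    by (rule sum.mono_neutral_cong_left) (auto simp: mult.commute)
  also have "\<dots> = (\<Sum>c<p. \<Sum>j<p ^ k. if coprime (j * p + c) p then \<phi> (j * p + c) else 0)"
    unfolding sum_lessThan_mult by (rule sum.swap)
  also have "\<dots> = (\<Sum>c\<in>{1..<p}. \<Sum>j<p ^ k. \<phi> (j * p + c))"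
  proof (rule sum.mono_neutral_cong_right)
    show "(\<Sum>j<p ^ k. if coprime (j * p + c) p then \<phi> (j * p + c) else 0) =
        (\<Sum>j<p ^ k. \<phi> (j * p + c))" if "c \<in> {1..<p}" for c
    proof -
      have "coprime c p" using that by (intro coprime_p_less) auto
      then have "coprime (j * p + c) p" for j
        by (simp add: coprime_p_iff dvd_add_right_iff)
      then show ?thesis by simp
    qed
  qed (auto simp: coprime_p_iff not_le)
  finally show ?thesis .
qed

text \<open>\<open>residue_sum\<close> depends on \<open>v\<close> only modulo \<open>p\<close>.
  Hence in each variable the reciprocals over one residue class modulo \<open>p\<close> factor out,
  and their sum contributes p^k.\<close>

lemma residue_sum_pideal: "residue_sum (p ^ Suc k) j v \<in> pideal (j * k)"
proof (induction j arbitrary: v)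
  case 0
  show ?case by simp
next
  case (Suc j)
  let ?\<psi> = "residue_sum (p ^ Suc k) j"
  have "residue_sum (p ^ Suc k) (Suc j) v =
      (\<Sum>c\<in>{1..<p}. \<Sum>i<p ^ k. 1 / of_nat (i * p + c) * ?\<psi> (v + (i * p + c)))"
    by (simp only: residue_sum.simps sum_units_split)
  also have "\<dots> = (\<Sum>c\<in>{1..<p}. (\<Sum>i<p ^ k. 1 / of_nat (i * p + c)) * ?\<psi> (v + c))"
  proof -
    have "?\<psi> (v + (i * p + c)) = ?\<psi> (v + c)" for i c
      using residue_sum_periodic[of "p ^ Suc k" j "v + c" i] by (simp only: add_ac)
    then show ?thesis by (simp only: sum_distrib_right)
  qed
  also have "\<dots> \<in> pideal (k + j * k)"
    by (intro pideal_sum pideal_mult sum_inverse_residue_class Suc coprime_p_less) auto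
  finally show ?case by simp
qed

text \<open>
  Differentiating \<open>trunc q ^ 5\<close> removes one of the five reciprocals; the fifth
  variable is then determined modulo \<open>q\<close> by the other four.
\<close>

lemma sum_T_weighted:
  assumes r: "r > 0" and q: "q = p ^ r"
  shows "of_nat q * (\<Sum>s=1..4. of_nat s * T q s) = 5 * residue_sum q 4 0"
proof -
  define w where "w b = (1 / of_nat b :: rat)" for b :: nat
  define M where "M = monomial_sum (units q) (\<lambda>_. 1)"
  have q0: "q > 0" using q by simp
  \<comment> \<open>The operator x d/dx multiplies the coefficient at \<open>b\<close> by
    \<open>b\<close>, cancelling the weight 1/b.\<close>
  have M: "fps_X * fps_deriv (trunc q) = M"
  proof (rule fps_ext)
    fix n
    show "(fps_X * fps_deriv (trunc q)) $ n = M $ n"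
      by (cases n) (auto simp: M_def monomial_sum_nth trunc_nth simp del: of_nat_Suc)
  qed
  have "fps_X * fps_deriv (trunc q ^ 5) =
      fps_const 5 * (trunc q * trunc q * trunc q * trunc q * M)"
    unfolding M[symmetric] by (simp add: fps_deriv_power eval_nat_numeral mult_ac)
  then have A: "(fps_X * fps_deriv (trunc q ^ 5)) $ n =
      5 * (trunc q * trunc q * trunc q * trunc q * M) $ n" for n
    by simp
  have B: "(fps_X * fps_deriv F) $ n = of_nat n * F $ n" for F :: "rat fps" and n
    by (cases n) simp_all
  have "of_nat (q * s) * T q s =
      5 * (trunc q * trunc q * trunc q * trunc q * M) $ (q * s)" for s
    unfolding T_def B[symmetric] by (rule A)
  then have "of_nat q * (\<Sum>s=1..4. of_nat s * T q s) =
      5 * (\<Sum>s=1..4. (trunc q * trunc q * trunc q * trunc q * M) $ (q * s))"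
    by (simp add: sum_distrib_left mult.assoc)
  also have "(\<Sum>s=1..4. (trunc q * trunc q * trunc q * trunc q * M) $ (q * s)) =
     (\<Sum>a\<in>units q. \<Sum>b\<in>units q. \<Sum>c\<in>units q. \<Sum>d\<in>units q. \<Sum>e\<in>units q. \<Sum>s=1..4.
        if a + b + c + d + e = q * s then w a * w b * w c * w d * 1 else 0)"
    unfolding trunc_def M_def monomial_sum_prod5_nth w_def by (rule sum_swap_nested5)
  also have "\<dots> = (\<Sum>a\<in>units q. \<Sum>b\<in>units q. \<Sum>c\<in>units q. \<Sum>d\<in>units q. \<Sum>e\<in>units q.
        if q dvd (a + b + c + d) + e then w a * w b * w c * w d else 0)"
  proof (intro sum.cong refl)
    fix a b c d e assume u: "a \<in> units q" "b \<in> units q" "c \<in> units q" "d \<in> units q" "e \<in> units q"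
    define N where "N = a + b + c + d + e"
    define t where "t = w a * w b * w c * w d"
    have "a > 0" using u by (auto dest: coprime_p_pos)
    then have N: "0 < N" "N < 5 * q" using u by (auto simp: N_def)
    \<comment> \<open>As 0 < N < 5q, a multiple of \<open>q\<close> equal to \<open>N\<close>
      belongs to exactly one \<open>s\<close> between 1 and 4.\<close>
    have "(\<Sum>s=1..4. if N = q * s then t else 0) = (if q dvd N then t else 0)"
    proof (cases "q dvd N")
      case True
      then obtain j where j: "N = q * j" by blast
      with N have "j \<in> {1..4}" by (cases j) auto
      have "(\<Sum>s=1..4. if N = q * s then t else 0) = (\<Sum>s=1..4. if j = s then t else 0)"
        using j q0 by (intro sum.cong) auto
      with \<open>j \<in> {1..4}\<close> True show ?thesis by (simp del: sum.cl_ivl_Suc)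
    next
      case False
      then show ?thesis by (intro trans[OF sum.neutral]) auto
    qed
    then show "(\<Sum>s=1..4. if a + b + c + d + e = q * s then w a * w b * w c * w d * 1 else 0) =
        (if q dvd (a + b + c + d) + e then w a * w b * w c * w d else 0)"
      unfolding N_def t_def by (simp only: mult_1_right)
  qed
  also have "\<dots> = (\<Sum>a\<in>units q. \<Sum>b\<in>units q. \<Sum>c\<in>units q. \<Sum>d\<in>units q.
        w a * w b * w c * w d * (if p dvd a + b + c + d then 0 else 1))"
    by (simp only: sum_units_complement[OF r q])
  also have "\<dots> = residue_sum q 4 0"
  proof -
    have "4 = Suc (Suc (Suc (Suc 0)))" by simp
    then show ?thesis
      by (simp only: residue_sum.simps sum_distrib_left add_0 w_def mult.assoc)
  qed
  finally show ?thesis .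
qed

text \<open>\<open>residue_sum\<close> supplies p^(4(r-1)). As 4(r-1) is at least 2r for
  \<open>r \<ge> 2\<close>, a factor p^r remains after division by \<open>q\<close>.\<close>

lemma sum_T_weighted_pideal:
  assumes r: "r \<ge> 2" and q: "q = p ^ r"
  shows "(\<Sum>s=1..4. of_nat s * T q s) \<in> pideal r"
proof -
  obtain k where k: "r = Suc k" "k \<ge> 1" using r by (cases r) auto
  have "of_nat q * (\<Sum>s=1..4. of_nat s * T q s) = 5 * residue_sum q 4 0"
    by (rule sum_T_weighted) (use r q in auto)
  also have "\<dots> \<in> pideal (4 * k)"
    using residue_sum_pideal[of k 4 0] q k by (intro pideal_mult_left) auto
  finally have "of_nat q * (\<Sum>s=1..4. of_nat s * T q s) \<in> pideal (r + r)"
    by (rule pideal_mono) (use k in simp)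
  then show ?thesis unfolding q of_nat_power pideal_cancel_p .
qed

text \<open>The symmetry turns the weighted sum T_1 + 2 T_2 + 3 T_3 + 4 T_4 into - 3 T_1 -
  T_2.\<close>

lemma T_pcong_2:
  assumes r: "r \<ge> 2" and q: "q = p ^ r"
  shows "pcong r (T q 2) (- 3 * T q 1)"
proof -
  have sym: "pcong r (T q 3) (- T q 2)" "pcong r (T q 4) (- T q 1)"
    using T_symmetric[of r q 2] T_symmetric[of r q 1] r q by (simp_all add: numeral_eq_Suc)
  have "(\<Sum>s=1..4. of_nat s * T q s) = T q 1 + 2 * T q 2 + 3 * T q 3 + 4 * T q 4"
    by (simp add: numeral_eq_Suc)
  also have "pcong r \<dots> (T q 1 + 2 * T q 2 + 3 * (- T q 2) + 4 * (- T q 1))"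
    by (intro pcong_add pcong_refl pcong_mult_left sym) simp_all
  finally have "pcong r 0 (T q 1 + 2 * T q 2 + 3 * (- T q 2) + 4 * (- T q 1))"
    using sum_T_weighted_pideal[OF r q] pcong_0_iff pcong_sym pcong_trans by blast
  then show ?thesis unfolding pcong_def by (simp add: algebra_simps)
qed

end

subsection \<open>Bernoulli numbers and elementary symmetric functions\<close>

text \<open>The logarithmic derivative of the product, cleared of denominators: each factor
  contributes - c/(1 - c x), whose expansion yields the power sums.\<close>

lemma newton_identity_fps:
  fixes c :: "'b \<Rightarrow> rat"
  assumes "finite A"
  shows "fps_deriv (\<Prod>a\<in>A. 1 - fps_const (c a) * fps_X) =
    - (Abs_fps (\<lambda>k. \<Sum>a\<in>A. c a ^ Suc k) * (\<Prod>a\<in>A. 1 - fps_const (c a) * fps_X))"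
  using assms
proof (induction A rule: finite_induct)
  case empty
  have "Abs_fps (\<lambda>k. 0) = (0 :: rat fps)" by (rule fps_ext) simp
  then show ?case by simp
next
  case (insert m A)
  define Q where "Q = (\<Prod>a\<in>A. 1 - fps_const (c a) * fps_X)"
  define G where "G = Abs_fps (\<lambda>k. \<Sum>a\<in>A. c a ^ Suc k)"
  define g where "g = Abs_fps (\<lambda>k. c m ^ Suc k)"
  define l where "l = 1 - fps_const (c m) * fps_X"
  have g: "g * l = fps_const (c m)"
  proof (rule fps_ext)
    fix n
    have "g * l = g - fps_const (c m) * (g * fps_X)"
      by (simp add: l_def algebra_simps)
    then have "(g * l) $ n = g $ n - c m * (g * fps_X) $ n"
      by (simp only: fps_sub_nth fps_mult_left_const_nth)
    then show "(g * l) $ n = fps_const (c m) $ n"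
      by (cases n) (simp_all add: g_def)
  qed
  have G: "Abs_fps (\<lambda>k. \<Sum>a\<in>insert m A. c a ^ Suc k) = g + G"
    using insert by (intro fps_ext) (simp add: g_def G_def)
  have "fps_deriv (l * Q) = - ((g + G) * (l * Q))"
  proof -
    have "fps_deriv (l * Q) = l * fps_deriv Q - fps_const (c m) * Q"
      by (simp add: l_def del: fps_const_neg flip: fps_const_neg)
    also have "\<dots> = - ((g + G) * (l * Q))"
      unfolding g[symmetric] using insert.IH[folded Q_def G_def] by (simp add: algebra_simps)
    finally show ?thesis .
  qed
  then show ?case unfolding G using insert by (simp add: Q_def l_def)
qed

lemma newton_identity:
  fixes c :: "'b \<Rightarrow> rat"
  assumes "finite A"
  shows "of_nat (Suc k) * (\<Prod>a\<in>A. 1 - fps_const (c a) * fps_X) $ Suc k =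
    - (\<Sum>i\<le>k. (\<Sum>a\<in>A. c a ^ Suc i) * (\<Prod>a\<in>A. 1 - fps_const (c a) * fps_X) $ (k - i))"
  using arg_cong[OF newton_identity_fps[OF assms, of c], of "\<lambda>F. F $ k"]
  by (simp add: fps_mult_nth atLeast0AtMost del: of_nat_Suc power_Suc)

text \<open>A geometric sum of exponentials. Its coefficients are power sums divided by factorials,
  which thereby become expressions in Bernoulli numbers.\<close>

lemma sum_fps_exp_bernoulli:
  "fps_X * (\<Sum>i<n. fps_exp (of_nat i)) = bernoulli_fps * (fps_exp (of_nat n) - 1)"
proof -
  have "fps_exp (of_nat n) - 1 = (fps_exp 1 - 1) * (\<Sum>i<n. fps_exp (of_nat i :: rat))"
    using power_diff_1_eq[of "fps_exp (1 :: rat)" n] by (simp add: fps_exp_power_mult)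
  then show ?thesis by (simp flip: bernoulli_fps_mult mult.assoc)
qed

context prime_gt_5
begin

lemma local_inverse_fact: "n < p \<Longrightarrow> 1 / fact n \<in> Z"
  using local_inverse[OF coprime_p_fact[of n]] by simp

text \<open>Comparing coefficients in \<open>bernoulli_fps_mult\<close> gives a recursion whose
  denominators are factorials of at most j + 1 < p.\<close>

lemma bernoulli_fps_local: "j \<le> p - 2 \<Longrightarrow> bernoulli_fps $ j \<in> Z"
proof (induction j rule: less_induct)
  case (less j)
  have "(bernoulli_fps * (fps_exp 1 - 1)) $ Suc j =
     (\<Sum>i=0..Suc j. bernoulli_fps $ i * (fps_exp 1 - 1) $ (Suc j - i))"
    by (rule fps_mult_nth)
  also have "\<dots> = bernoulli_fps $ j + (\<Sum>i<j. bernoulli_fps $ i * (1 / fact (Suc j - i)))"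
    by (simp add: atLeast0AtMost lessThan_Suc_atMost[symmetric])
  finally have "bernoulli_fps $ j =
      (if j = 0 then 1 else 0) - (\<Sum>i<j. bernoulli_fps $ i * (1 / fact (Suc j - i)))"
    by (simp add: bernoulli_fps_mult)
  also have "\<dots> \<in> Z"
    using less by (intro local_diff local_sum local_mult local_inverse_fact) auto
  finally show ?case .
qed

lemma bernoulli_local: "j \<le> p - 2 \<Longrightarrow> bernoulli j \<in> Z"
  unfolding bernoulli_def using local_of_nat[of "fact j"]
  by (intro local_mult bernoulli_fps_local) simp_all

text \<open>In the Cauchy product the index j = k contributes p B_k; a smaller j carries p^(k+1-j),
  with exponent at least 2, over a factorial prime to \<open>p\<close>.\<close>

lemma power_sum_pcong:
  assumes k: "1 \<le> k" "k \<le> p - 2"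
  shows "pcong 2 (\<Sum>i\<in>{1..<p}. of_nat i ^ k) (of_nat p * bernoulli k)"
proof -
  have "(\<Sum>i<p. fps_exp (of_nat i :: rat)) $ k =
      (bernoulli_fps * (fps_exp (of_nat p) - 1)) $ Suc k"
    by (simp flip: sum_fps_exp_bernoulli)
  also have "\<dots> = (\<Sum>j=0..Suc k. bernoulli_fps $ j * (fps_exp (of_nat p) - 1) $ (Suc k - j))"
    by (rule fps_mult_nth)
  also have "\<dots> = bernoulli_fps $ k * of_nat p +
      (\<Sum>j<k. bernoulli_fps $ j * (of_nat p ^ (Suc k - j) / fact (Suc k - j)))"
    by (simp add: atLeast0AtMost lessThan_Suc_atMost[symmetric])
  finally have "fact k * (\<Sum>i<p. fps_exp (of_nat i :: rat)) $ k = of_nat p * bernoulli k +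
      fact k * (\<Sum>j<k. bernoulli_fps $ j * (of_nat p ^ (Suc k - j) / fact (Suc k - j)))"
    by (simp add: bernoulli_def distrib_left mult_ac)
  moreover have "fact k * (\<Sum>i<p. fps_exp (of_nat i :: rat)) $ k = (\<Sum>i\<in>{1..<p}. of_nat i ^ k)"
  proof -
    have "fact k * (\<Sum>i<p. fps_exp (of_nat i :: rat)) $ k = (\<Sum>i<p. of_nat i ^ k)"
      by (simp add: fps_sum_nth sum_distrib_left)
    \<comment> \<open>The term i = 0 vanishes because k is positive.\<close>
    also have "\<dots> = (\<Sum>i\<in>{1..<p}. of_nat i ^ k)"
      using k by (intro sum.mono_neutral_right) (auto simp: not_le)
    finally show ?thesis .
  qed
  moreover have "fact k * (\<Sum>j<k. bernoulli_fps $ j * (of_nat p ^ (Suc k - j) / fact (Suc k - j)))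
      \<in> pideal 2"
  proof (intro pideal_mult_left pideal_sum)
    show "fact k \<in> Z" using local_of_nat[of "fact k"] by simp
    fix j assume "j \<in> {..<k}"
    then have j: "j < k" by simp
    then show "bernoulli_fps $ j \<in> Z" using k by (intro bernoulli_fps_local) simp
    have "of_nat p ^ (Suc k - j) \<in> pideal 2"
      using j by (intro pideal_mono[OF pideal_p_power]) simp
    then have "of_nat p ^ (Suc k - j) * (1 / fact (Suc k - j)) \<in> pideal 2"
      using k by (intro pideal_mult_right local_inverse_fact) simp_all
    then show "of_nat p ^ (Suc k - j) / fact (Suc k - j) \<in> pideal 2" by simp
  qed
  ultimately show ?thesis by (simp add: pcong_def)
qed

lemma power_sum_pideal:
  assumes k: "1 \<le> k" "k \<le> p - 2"
  shows "(\<Sum>i\<in>{1..<p}. of_nat i ^ k) \<in> pideal 1"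
proof -
  have "pcong 1 (\<Sum>i\<in>{1..<p}. of_nat i ^ k) (of_nat p * bernoulli k)"
    by (rule pcong_mono[OF power_sum_pcong[OF k]]) simp
  moreover have "of_nat p * bernoulli k \<in> pideal 1"
    using k by (intro pideal_mult_right[OF pideal_p] bernoulli_local) simp
  ultimately show ?thesis unfolding pcong_def using pideal_add by fastforce
qed

text \<open>The elementary symmetric function of 1, ..., p - 1, with the sign (-1)^k
  included.\<close>

definition esym :: "nat \<Rightarrow> rat" where
  "esym k = (\<Prod>i\<in>{1..<p}. 1 - fps_const (of_nat i) * fps_X) $ k"

lemma esym_local [simp, intro]: "esym k \<in> Z"
proof -
  have "fps_local (\<Prod>i\<in>A. 1 - fps_const (of_nat i) * fps_X)" for A :: "nat set"
    using fps_local_basic(2)[of 1]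
    by (induction A rule: infinite_finite_induct)
      (auto intro!: fps_local_mult fps_local_diff)
  then show ?thesis by (simp add: esym_def fps_local_def)
qed

lemma esym_recursion:
  "of_nat (Suc k) * esym (Suc k) =
     - (\<Sum>i\<le>k. (\<Sum>a\<in>{1..<p}. of_nat a ^ Suc i) * esym (k - i))"
  unfolding esym_def by (rule newton_identity) simp

lemma esym_0 [simp]: "esym 0 = 1"
proof -
  have "(\<Prod>i\<in>A. 1 - fps_const (of_nat i) * fps_X) $ 0 = (1 :: rat)" for A :: "nat set"
    by (induction A rule: infinite_finite_induct) simp_all
  then show ?thesis by (simp add: esym_def)
qed

lemma esym_pideal: "1 \<le> k \<Longrightarrow> k \<le> p - 2 \<Longrightarrow> esym k \<in> pideal 1"
proof -
  assume k: "1 \<le> k" "k \<le> p - 2"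
  then obtain m where m: "k = Suc m" by (cases k) auto
  have "of_nat k * esym k \<in> pideal 1"
    unfolding m esym_recursion
    by (intro pideal_uminus pideal_sum pideal_mult_right esym_local power_sum_pideal)
      (use k m in auto)
  moreover have "coprime k p" using k by (intro coprime_p_less) auto
  ultimately show ?thesis by (simp only: pideal_cancel_unit)
qed

text \<open>In Newton's identity every summand with two factors of positive index is divisible by
  p^2, which leaves the power sum of exponent p - 5. The factor p - 5 becomes - 5 because p^2
  divides \<open>of_nat p * esym (p - 5)\<close>.\<close>

lemma esym_p_minus_5: "pcong 2 (5 * esym (p - 5)) (of_nat p * bernoulli (p - 5))"
proof -
  obtain m where m: "p - 5 = Suc m" using p_gt_5 by (metis Suc_pred zero_less_diff)
  have "of_nat (p - 5) * esym (p - 5) =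
      - (\<Sum>i\<le>m. (\<Sum>a\<in>{1..<p}. of_nat a ^ Suc i) * esym (m - i))"
    unfolding m by (rule esym_recursion)
  also have "(\<Sum>i\<le>m. (\<Sum>a\<in>{1..<p}. of_nat a ^ Suc i) * esym (m - i)) =
      (\<Sum>i<m. (\<Sum>a\<in>{1..<p}. of_nat a ^ Suc i) * esym (m - i))
       + (\<Sum>a\<in>{1..<p}. of_nat a ^ Suc m)"
    by (simp flip: lessThan_Suc_atMost)
  also have "pcong 2 (- \<dots>) (- (0 + of_nat p * bernoulli (Suc m)))"
  proof (intro pcong_uminus pcong_add power_sum_pcong)
    have "(\<Sum>a\<in>{1..<p}. of_nat a ^ Suc i) * esym (m - i) \<in> pideal (1 + 1)" if "i < m" for i
      using that m by (intro pideal_mult power_sum_pideal esym_pideal) auto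
    then show "pcong 2 (\<Sum>i<m. (\<Sum>a\<in>{1..<p}. of_nat a ^ Suc i) * esym (m - i)) 0"
      unfolding pcong_0_iff by (intro pideal_sum) (simp add: numeral_2_eq_2)
  qed (use m in auto)
  finally have 1: "pcong 2 (of_nat (p - 5) * esym (p - 5)) (- (of_nat p * bernoulli (p - 5)))"
    by (simp add: m)
  have "of_nat p * esym (p - 5) \<in> pideal (1 + 1)"
    using p_gt_5 by (intro pideal_mult pideal_p esym_pideal) auto
  then have 2: "pcong 2 (of_nat p * esym (p - 5)) 0"
    by (simp add: pcong_0_iff numeral_2_eq_2)
  from pcong_diff[OF 2 1] show ?thesis
    using p_gt_5 by (simp add: of_nat_diff algebra_simps)
qed

text \<open>
  \<open>esym (p - 1 - j) / (p - 1)!\<close> is, up to sign, the \<open>j\<close>-th elementary symmetric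
  function of the reciprocals of $1, \dots, p - 1$.
\<close>

definition wolst_prod :: "rat \<Rightarrow> rat" where
  "wolst_prod x = (\<Prod>i\<in>{1..<p}. 1 - of_nat p * x / of_nat i)"

lemma prod_one_to_p: "(\<Prod>i\<in>{1..<p}. of_nat i) = (fact (p - 1) :: rat)"
proof -
  have "{1..<p} = {1..p - 1}" using p_pos by auto
  then show ?thesis by (simp add: fact_prod flip: of_nat_prod)
qed

lemma even_p_minus_1: "even (p - 1)"
  using prime_p p_gt_5 prime_odd_nat[of p] by simp

text \<open>The factorial clears the denominators and leaves the product of the p x - i, the number
  of signs being even. This is the value at p x of the reversal of the polynomial with coefficients
  \<open>esym\<close>.\<close>

lemma wolst_prod_eq_sum:
  "fact (p - 1) * wolst_prod x = (\<Sum>j\<le>p - 1. esym (p - 1 - j) * (of_nat p * x) ^ j)"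
proof -
  define Q where "Q = (\<Prod>i\<in>{1..<p}. [:1, - of_nat i:] :: rat poly)"
  have Q: "Polynomial.coeff Q k = esym k" for k
  proof -
    have "fps_of_poly Q = (\<Prod>i\<in>{1..<p}. 1 - fps_const (of_nat i) * fps_X)"
      unfolding Q_def fps_of_poly_prod
      by (intro prod.cong refl) (simp add: fps_of_poly_pCons mult.commute)
    then show ?thesis by (simp add: esym_def flip: fps_of_poly_nth)
  qed
  have deg: "degree Q = p - 1"
    unfolding Q_def by (subst degree_prod_eq_sum_degree) auto
  have R: "reflect_poly Q = (\<Prod>i\<in>{1..<p}. [:- of_nat i, 1:])"
    unfolding Q_def reflect_poly_prod
    by (intro prod.cong refl) (simp add: reflect_poly_pCons)
  have degR: "degree (reflect_poly Q) = p - 1"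
    unfolding R by (subst degree_prod_eq_sum_degree) auto
  have "fact (p - 1) * wolst_prod x = (\<Prod>i\<in>{1..<p}. of_nat i * (1 - of_nat p * x / of_nat i))"
    by (simp only: wolst_prod_def prod.distrib prod_one_to_p)
  also have "\<dots> = (\<Prod>i\<in>{1..<p}. - 1 * (of_nat p * x - of_nat i))"
    by (intro prod.cong refl) (simp add: field_simps)
  also have "\<dots> = (\<Prod>i\<in>{1..<p}. of_nat p * x - of_nat i)"
    unfolding prod.distrib using even_p_minus_1 by simp
  also have "\<dots> = poly (reflect_poly Q) (of_nat p * x)"
    unfolding R by (simp add: poly_prod)
  also have "\<dots> = (\<Sum>j\<le>p - 1. esym (p - 1 - j) * (of_nat p * x) ^ j)"
    unfolding poly_altdef degR by (simp add: coeff_reflect_poly deg Q)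
  finally show ?thesis .
qed

text \<open>Replacing i by p - i turns i - p(1 - x) into -(i - p x), and the number p - 1 of signs
  is even.\<close>

lemma wolst_prod_reflect: "wolst_prod (1 - x) = wolst_prod x"
proof -
  have "fact (p - 1) * wolst_prod y = (\<Prod>i\<in>{1..<p}. of_nat i - of_nat p * y)" for y
    unfolding wolst_prod_def prod_one_to_p[symmetric] prod.distrib[symmetric]
    by (intro prod.cong refl) (simp add: field_simps)
  note eq = this
  have "fact (p - 1) * wolst_prod (1 - x) = (\<Prod>i\<in>{1..<p}. of_nat i - of_nat p * (1 - x))"
    by (rule eq)
  also have "\<dots> = (\<Prod>i\<in>{1..<p}. - 1 * (of_nat i - of_nat p * x))"
    by (rule prod.reindex_bij_witness[of _ "\<lambda>i. p - i" "\<lambda>i. p - i"])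
      (auto simp: of_nat_diff algebra_simps)
  also have "\<dots> = fact (p - 1) * wolst_prod x"
    unfolding prod.distrib eq using even_p_minus_1 by simp
  finally show ?thesis by simp
qed

text \<open>p! times the binomial coefficient is a falling factorial of p k: the first factor is p
  k, the others give (p - 1)! times \<open>wolst_prod (of_nat k)\<close>.\<close>

lemma wolst_prod_of_nat: "of_nat ((p * k) choose p) = of_nat k * wolst_prod (of_nat k)"
proof -
  have "fact p * of_nat ((p * k) choose p) = (\<Prod>i=0..<p. of_nat (p * k) - of_nat i :: rat)"
    by (simp add: binomial_gbinomial gbinomial_mult_fact)
  also have "\<dots> = of_nat (p * k) * (\<Prod>i\<in>{1..<p}. of_nat (p * k) - of_nat i)"
    by (subst prod.atLeast_Suc_lessThan) simp_all
  also have "(\<Prod>i\<in>{1..<p}. of_nat (p * k) - of_nat i :: rat) =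
      (\<Prod>i\<in>{1..<p}. - 1 * (of_nat i * (1 - of_nat p * of_nat k / of_nat i)))"
    by (intro prod.cong refl) (simp add: field_simps)
  also have "\<dots> = fact (p - 1) * wolst_prod (of_nat k)"
    unfolding prod.distrib prod_one_to_p wolst_prod_def using even_p_minus_1 by simp
  also have "of_nat (p * k) * (fact (p - 1) * wolst_prod (of_nat k)) =
      fact p * (of_nat k * wolst_prod (of_nat k))"
    using fact_reduce[of p, where 'a = rat] by simp
  finally show ?thesis by simp
qed

end

lemma one_minus_X_power_nth: "((1 - fps_X) ^ n) $ k = ((-1) ^ k * of_nat (n choose k) :: rat)"
proof (induction n arbitrary: k)
  case (Suc n)
  have "((1 - fps_X) ^ Suc n) $ k = ((1 - fps_X) ^ n * (1 - fps_X ^ 1) :: rat fps) $ k"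
    by (simp add: mult.commute)
  also have "\<dots> = (-1) ^ k * of_nat (Suc n choose k)"
    unfolding mult_one_minus_X_power_nth Suc by (cases k) (simp_all add: algebra_simps)
  finally show ?case .
qed (simp add: binomial_eq_0_iff)

context prime_gt_5
begin

lemma odd_p [simp]: "odd p"
  using prime_p p_gt_5 prime_odd_nat[of p] by simp

lemma coprime_small [simp]:
  "coprime 2 p" "coprime 3 p" "coprime 5 p" "coprime 6 p" "coprime 24 p"
proof -
  show *: "coprime 2 p" "coprime 3 p" "coprime 5 p"
    using p_gt_5 by (simp_all add: coprime_p_less)
  then have "coprime (2 * 3) p" "coprime (2 * 2 * 2 * 3) p"
    by (simp_all only: coprime_mult_left_iff simp_thms)
  then show "coprime 6 p" "coprime 24 p" by simp_all
qed

lemma local_divide_small [simp]: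
  "x \<in> Z \<Longrightarrow> x / 2 \<in> Z" "x \<in> Z \<Longrightarrow> x / 6 \<in> Z" "x \<in> Z \<Longrightarrow> x / 24 \<in> Z"
  using local_divide[of x 2] local_divide[of x 6] local_divide[of x 24] by simp_all

lemma pideal_divide_small:
  "x \<in> pideal k \<Longrightarrow> x / 2 \<in> pideal k" "x \<in> pideal k \<Longrightarrow> x / 6 \<in> pideal k"
  "x \<in> pideal k \<Longrightarrow> x / 24 \<in> pideal k"
  using pideal_cancel_unit[of 2 "x / 2" k] pideal_cancel_unit[of 6 "x / 6" k]
    pideal_cancel_unit[of 24 "x / 24" k] by simp_all

subsection \<open>The product \<open>wolst_prod\<close> modulo the sixth power of \<open>p\<close>\<close>

text \<open>Modulo p^6 the product is a polynomial of degree at most 4 in x. The reflection x -> 1 -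
  x, tested at 0 and 2, makes it a polynomial in x(1 - x).\<close>

lemma wolst_prod_expansion:
  obtains \<alpha> \<beta> where "\<alpha> \<in> pideal 3" "\<beta> \<in> pideal 5"
    "pcong 6 (5 * \<beta>) (- (of_nat p ^ 5 * bernoulli (p - 5)))"
    "\<And>n. pcong 6 (wolst_prod (of_nat n))
       (1 + \<alpha> * (of_nat n * (1 - of_nat n)) + \<beta> * (of_nat n * (1 - of_nat n)) ^ 2)"
proof -
  define a where "a j = of_nat p ^ j * (esym (p - 1 - j) * (1 / fact (p - 1)))" for j
  have inv: "1 / fact (p - 1) \<in> Z" by (intro local_inverse_fact) simp
  have a: "a j \<in> pideal (j + 1)" if "1 \<le> j" "j \<le> p - 2" for j
    unfolding a_def using that
    by (intro pideal_mult[OF pideal_p_power pideal_mult_right] esym_pideal inv) auto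
  have a': "a j \<in> pideal j" for j
    unfolding a_def by (intro pideal_mult_right[OF pideal_p_power] local_mult esym_local inv)
  have wolst_prod: "wolst_prod x = (\<Sum>j\<le>p - 1. a j * x ^ j)" for x
  proof -
    have "wolst_prod x = 1 / fact (p - 1) * (fact (p - 1) * wolst_prod x)" by simp
    then show ?thesis
      unfolding wolst_prod_eq_sum sum_distrib_left by (simp add: a_def power_mult_distrib mult_ac)
  qed
  have split: "{..p - 1} = {..4} \<union> {5..p - 1}" using p_gt_5 by auto
  have "wolst_prod 0 = 1" by (simp add: wolst_prod_def)
  moreover have "wolst_prod 0 = a 0"
    unfolding wolst_prod split by (subst sum.union_disjoint) (auto simp: power_0_left numeral_eq_Suc)
  ultimately have a0: "a 0 = 1" by simp
  have w: "pcong 6 (wolst_prod x) (1 + a 1 * x + a 2 * x ^ 2 + a 3 * x ^ 3 + a 4 * x ^ 4)"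
    if x: "x \<in> Z" for x
  proof -
    have "wolst_prod x = (\<Sum>j\<le>4. a j * x ^ j) + (\<Sum>j=5..p - 1. a j * x ^ j)"
      unfolding wolst_prod split by (rule sum.union_disjoint) auto
    moreover have "(\<Sum>j=5..p - 1. a j * x ^ j) \<in> pideal 6"
    proof (intro pideal_sum pideal_mult_right local_power x)
      fix j assume "j \<in> {5..p - 1}"
      then consider "j = 5" | "j \<ge> 6" by force
      then show "a j \<in> pideal 6"
      proof cases
        case 1
        \<comment> \<open>The bound for \<open>a 5\<close> requires 5 <= p - 2, and p > 5 alone
          falls one short of it.\<close>
        have "p \<noteq> 6" using odd_p by (intro notI) (simp del: odd_p)
        then show ?thesis using 1 a[of 5] p_gt_5 by simp
      next
        case 2
        then show ?thesis by (rule pideal_mono[OF a'])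
      qed
    qed
    moreover have "(\<Sum>j\<le>4. a j * x ^ j) = 1 + a 1 * x + a 2 * x ^ 2 + a 3 * x ^ 3 + a 4 * x ^ 4"
      using a0 by (simp add: numeral_eq_Suc)
    ultimately show ?thesis by (simp add: pcong_def)
  qed
  have I2: "a 2 \<in> pideal 3" "a 4 \<in> pideal 5"
    using a[of 2] a[of 4] p_gt_5 by simp_all
  have "wolst_prod 1 = 1"
    using wolst_prod_reflect[of 0] \<open>wolst_prod 0 = 1\<close> by simp
  moreover have "pcong 6 (1 + a 1 * 1 + a 2 * 1 ^ 2 + a 3 * 1 ^ 3 + a 4 * 1 ^ 4) (wolst_prod 1)"
    by (intro pcong_sym[OF w]) simp
  ultimately have e1: "a 1 + a 2 + a 3 + a 4 \<in> pideal 6"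
    by (simp add: pcong_def algebra_simps)
  have "pcong 6 (1 + a 1 * 2 + a 2 * 2 ^ 2 + a 3 * 2 ^ 3 + a 4 * 2 ^ 4) (wolst_prod 2)"
    by (intro pcong_sym[OF w]) simp
  also have "wolst_prod 2 = wolst_prod (- 1)"
    using wolst_prod_reflect[of 2] by simp
  also have "pcong 6 \<dots> (1 + a 1 * (-1) + a 2 * (-1) ^ 2 + a 3 * (-1) ^ 3 + a 4 * (-1) ^ 4)"
    by (intro w) simp
  finally have "of_nat 3 * (a 1 + a 2 + 3 * a 3 + 5 * a 4) \<in> pideal 6"
    unfolding pcong_def by (simp add: algebra_simps)
  then have e2: "a 1 + a 2 + 3 * a 3 + 5 * a 4 \<in> pideal 6"
    by (subst (asm) pideal_cancel_unit) simp_all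
  have "of_nat 2 * (a 3 + 2 * a 4) \<in> pideal 6"
    using pideal_diff[OF e2 e1] by (simp add: algebra_simps)
  then have e3: "a 3 + 2 * a 4 \<in> pideal 6"
    by (subst (asm) pideal_cancel_unit) simp_all
  have e4: "a 1 + a 2 - a 4 \<in> pideal 6"
    using pideal_diff[OF e1 e3] by (simp add: algebra_simps)
  show ?thesis
  proof (rule that)
    \<comment> \<open>The coefficient of x^4 forces \<open>\<beta> = a 4\<close>, that of x^2 then
      \<open>\<alpha> = a 4 - a 2\<close>. The latter is congruent to \<open>a 1\<close>, but in
      this form its divisibility by p^3 is immediate.\<close>
    show "a 4 - a 2 \<in> pideal 3"
      using I2 by (intro pideal_diff) (auto intro: pideal_mono)
    show "a 4 \<in> pideal 5" by (rule I2)
    show "pcong 6 (wolst_prod (of_nat n)) (1 + (a 4 - a 2) * (of_nat n * (1 - of_nat n))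
        + a 4 * (of_nat n * (1 - of_nat n)) ^ 2)" for n
    proof -
      let ?x = "of_nat n :: rat"
      have "(1 + a 1 * ?x + a 2 * ?x ^ 2 + a 3 * ?x ^ 3 + a 4 * ?x ^ 4) -
        (1 + (a 4 - a 2) * (?x * (1 - ?x)) + a 4 * (?x * (1 - ?x)) ^ 2) =
        (a 1 + a 2 - a 4) * ?x + (a 3 + 2 * a 4) * ?x ^ 3"
        by (simp add: algebra_simps eval_nat_numeral)
      also have "\<dots> \<in> pideal 6"
        by (intro pideal_add pideal_mult_right[OF e3] pideal_mult_right[OF e4] local_power)
          simp_all
      finally have "pcong 6 (1 + a 1 * ?x + a 2 * ?x ^ 2 + a 3 * ?x ^ 3 + a 4 * ?x ^ 4)
        (1 + (a 4 - a 2) * (?x * (1 - ?x)) + a 4 * (?x * (1 - ?x)) ^ 2)"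
        by (simp add: pcong_def)
      with w[OF local_of_nat] show ?thesis by (rule pcong_trans)
    qed
    \<comment> \<open>The factor 1/(p - 1)! in \<open>a 4\<close> is - 1 modulo \<open>p\<close>;
      the error is absorbed because p^5 already divides \<open>a 4\<close>.\<close>
    have "[fact (p - 1) = - 1] (mod int p)"
      using prime_p by (rule wilson_theorem)
    then have "int p dvd int (fact (p - 1) + 1)"
      by (simp add: cong_iff_dvd_diff add.commute)
    then have "of_nat (fact (p - 1) + 1) \<in> pideal 1"
      by (intro pideal_of_nat) (simp only: int_dvd_int_iff)
    then have "fact (p - 1) + 1 \<in> pideal 1"
      by (simp add: add.commute)
    then have "(5 * a 4) * (fact (p - 1) + 1) \<in> pideal (5 + 1)"
      by (rule pideal_mult[OF pideal_mult_left[OF _ I2(2)], rotated]) simp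
    then have "pcong 6 ((5 * a 4) * (fact (p - 1) + 1) - of_nat p ^ 4 * (5 * esym (p - 5)))
       (0 - of_nat p ^ 4 * (of_nat p * bernoulli (p - 5)))"
      using esym_p_minus_5 pcong_cancel_p[of 4 2] by (intro pcong_diff) (simp_all add: pcong_0_iff)
    moreover have "(5 * a 4) * (fact (p - 1) + 1) - of_nat p ^ 4 * (5 * esym (p - 5)) = 5 * a 4"
      by (simp add: a_def field_simps)
    moreover have "0 - of_nat p ^ 4 * (of_nat p * bernoulli (p - 5)) =
        - (of_nat p ^ 5 * bernoulli (p - 5))"
      by (simp add: numeral_eq_Suc)
    ultimately show "pcong 6 (5 * a 4) (- (of_nat p ^ 5 * bernoulli (p - 5)))"
      by (simp only:)
  qed
qed

subsection \<open>The case of the first power of \<open>p\<close>\<close>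

text \<open>
  Modulo \<open>p\<close> the reciprocal of \<open>k\<close> is $(-1)^{k-1} \binom{p}{k} / p$, so
  \<open>trunc p\<close> may be replaced by $(1 - x^p - (1 - x)^p) / p$.
\<close>

definition frob_quot :: "rat fps" where
  "frob_quot = fps_const (1 / of_nat p) * (1 - fps_X ^ p - (1 - fps_X) ^ p)"

text \<open>By Pascal's rule two neighbouring coefficients add up to \<open>p choose Suc j\<close>,
  which \<open>p\<close> divides, so each step changes the sign.\<close>

lemma choose_p_minus_1: "j < p \<Longrightarrow> pcong 1 (of_nat ((p - 1) choose j)) ((-1) ^ j)"
proof (induction j)
  case (Suc j)
  have "Suc j * (p choose Suc j) = p * ((p - 1) choose j)"
    using times_binomial_minus1_eq[of "Suc j" p] by simp
  then have "of_nat (Suc j * (p choose Suc j)) = (of_nat (p * ((p - 1) choose j)) :: rat)"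
    by (simp only:)
  then have "of_nat (Suc j) * of_nat (p choose Suc j) \<in> pideal 1"
    using pideal_mult_right[OF pideal_p local_of_nat] by (simp only: of_nat_mult)
  then have "of_nat (p choose Suc j) \<in> pideal 1"
    using Suc.prems by (subst (asm) pideal_cancel_unit) (auto intro: coprime_p_less)
  then have "pcong 1 (of_nat (p choose Suc j) - of_nat ((p - 1) choose j)) (0 - (-1) ^ j)"
    using Suc by (intro pcong_diff) (simp_all add: pcong_0_iff)
  moreover have "p choose Suc j = ((p - 1) choose j) + ((p - 1) choose Suc j)"
    using binomial_Suc_Suc[of "p - 1" j] by simp
  ultimately show ?case by simp
qed simp

text \<open>Absorption gives (p choose k)/p = (p-1 choose k-1)/k, whose numerator is a sign modulo
  \<open>p\<close>. At k = 0 and k = p the terms 1 and x^p cancel the ends of (1 - x)^p, as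
  \<open>p\<close> is odd.\<close>

lemma frob_quot_pcong: "fps_pcong 1 frob_quot (trunc p)"
  unfolding fps_pcong_def
proof
  fix k
  have F: "frob_quot $ k = ((if k = 0 then 1 else 0) - (if k = p then 1 else 0)
      - (-1) ^ k * of_nat (p choose k)) / of_nat p"
    by (simp add: frob_quot_def one_minus_X_power_nth)
  consider "k = 0" | "k = p" | "k > p" | "0 < k" "k < p" by linarith
  then show "pcong 1 (frob_quot $ k) (trunc p $ k)"
  proof cases
    case 4
    then obtain j where j: "k = Suc j" by (cases k) auto
    have cop: "coprime k p" using 4 by (rule coprime_p_less)
    have "k * (p choose k) = p * ((p - 1) choose j)"
      unfolding j using times_binomial_minus1_eq[of "Suc j" p] by simp
    then have "of_nat (k * (p choose k)) = (of_nat (p * ((p - 1) choose j)) :: rat)"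
      by (simp only:)
    then have "of_nat (p choose k) / of_nat p = (1 / of_nat k * of_nat ((p - 1) choose j) :: rat)"
      using 4 by (simp add: field_simps)
    note choose = this
    have "frob_quot $ k = - ((-1) ^ k) * (of_nat (p choose k) / of_nat p)"
      unfolding F using 4 by simp
    also have "\<dots> = - ((-1) ^ k) * (1 / of_nat k * of_nat ((p - 1) choose j))"
      by (simp only: choose)
    also have "pcong 1 \<dots> (- ((-1) ^ k) * (1 / of_nat k * (-1) ^ j))"
      using cop 4 j by (intro pcong_mult_left choose_p_minus_1 local_inverse local_uminus local_power)
        simp_all
    also have "- ((-1) ^ k) * (1 / of_nat k * (-1) ^ j) = trunc p $ k"
      using cop 4 by (simp add: trunc_nth j flip: power_mult_distrib)
    finally show ?thesis .
  next
    case 1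
    then have "frob_quot $ k = 0" unfolding F by simp
    with 1 show ?thesis by (simp add: trunc_nth)
  next
    case 2
    then have "frob_quot $ k = 0" unfolding F by simp
    with 2 show ?thesis by (simp add: trunc_nth)
  next
    case 3
    then have "frob_quot $ k = 0" unfolding F by simp
    with 3 show ?thesis by (simp add: trunc_nth)
  qed
qed

lemma T_p_pcong: "pcong 1 ((frob_quot ^ 5) $ (p * s)) (T p s)"
  using fps_pcong_power[OF frob_quot_pcong trunc_local, of 5]
  by (simp add: fps_pcong_def T_def)

lemma frob_quot_power_local: "(frob_quot ^ 5) $ n \<in> Z"
  using fps_local_power[OF fps_pcong_local[OF frob_quot_pcong trunc_local]]
  by (simp add: fps_local_def)

text \<open>Each factor 1 - x^p subtracts the coefficient \<open>p\<close> places lower, which gives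
  inductions on \<open>j\<close>.\<close>

lemma truncated_coeffs:
  shows "((1 - fps_X) ^ m * (1 - fps_X ^ p) ^ j) $ 0 = (1 :: rat)"
    and "((1 - fps_X) ^ m * (1 - fps_X ^ p) ^ j) $ p = (- of_nat (m choose p) - of_nat j :: rat)"
    and "((1 - fps_X) ^ m * (1 - fps_X ^ p) ^ j) $ (2 * p) =
      (of_nat (m choose (2 * p)) + of_nat j * of_nat (m choose p)
        + of_nat j * (of_nat j - 1) / 2 :: rat)"
proof -
  have step: "(1 - fps_X) ^ m * (1 - fps_X ^ p) ^ Suc i =
      ((1 - fps_X) ^ m * (1 - fps_X ^ p) ^ i) * (1 - fps_X ^ p :: rat fps)" for i
    by (simp only: power_Suc2 mult.assoc)
  show 0: "((1 - fps_X) ^ m * (1 - fps_X ^ p) ^ j) $ 0 = (1 :: rat)" for j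
    by (simp add: fps_power_zeroth power_0_left)
  show 1: "((1 - fps_X) ^ m * (1 - fps_X ^ p) ^ j) $ p = (- of_nat (m choose p) - of_nat j :: rat)"
    for j
  proof (induction j)
    case (Suc j)
    show ?case unfolding step mult_one_minus_X_power_nth Suc diff_self_eq_0 0 by simp
  qed (use odd_p in \<open>simp add: one_minus_X_power_nth\<close>)
  show "((1 - fps_X) ^ m * (1 - fps_X ^ p) ^ j) $ (2 * p) =
      (of_nat (m choose (2 * p)) + of_nat j * of_nat (m choose p)
        + of_nat j * (of_nat j - 1) / 2 :: rat)"
  proof (induction j)
    case (Suc j)
    have "2 * p - p = p" by simp
    then show ?case unfolding step mult_one_minus_X_power_nth Suc
      by (simp only: 1) (simp add: field_simps)
  qed (simp add: one_minus_X_power_nth)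
qed

lemma frob_quot_power_nth:
  "of_nat p ^ 5 * (frob_quot ^ 5) $ n =
     (let g = \<lambda>k j. ((1 - fps_X) ^ (p * k) * (1 - fps_X ^ p) ^ j) $ n
      in g 0 5 - 5 * g 1 4 + 10 * g 2 3 - 10 * g 3 2 + 5 * g 4 1 - g 5 0)"
proof -
  define A where "A = (1 - fps_X ^ p :: rat fps)"
  define u where "u = ((1 - fps_X) ^ p :: rat fps)"
  have "fps_const (of_nat p) * frob_quot = A - u"
    by (simp add: frob_quot_def A_def u_def flip: mult.assoc)
  then have "fps_const (of_nat p ^ 5) * frob_quot ^ 5 = (A - u) ^ 5"
    by (metis fps_const_power power_mult_distrib)
  also have "\<dots> = u ^ 0 * A ^ 5 - fps_const 5 * (u ^ 1 * A ^ 4) + fps_const 10 * (u ^ 2 * A ^ 3)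
      - fps_const 10 * (u ^ 3 * A ^ 2) + fps_const 5 * (u ^ 4 * A ^ 1) - u ^ 5 * A ^ 0"
    by (simp add: eval_nat_numeral algebra_simps flip: numeral_fps_const)
  finally show ?thesis
    unfolding A_def u_def Let_def power_mult[symmetric]
    by (metis (no_types, lifting) fps_mult_left_const_nth fps_sub_nth fps_add_nth)
qed

text \<open>Trinomial revision: the other three binomial coefficients have the form (p m choose p),
  which \<open>wolst_prod_of_nat\<close> evaluates.\<close>

lemma choose_2p: "2 * wolst_prod 2 * of_nat ((p * k) choose (2 * p)) =
    of_nat k * (of_nat k - 1) * (wolst_prod (of_nat k) * wolst_prod (of_nat k - 1))" if "k \<ge> 2"
proof -
  have "((p * k) choose (2 * p)) * ((2 * p) choose p) =
      ((p * k) choose p) * ((p * k - p) choose (2 * p - p))"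
    using that by (intro choose_mult) (simp_all add: mult.commute)
  also have "2 * p - p = p" by simp
  also have "p * k - p = p * (k - 1)" by (simp add: diff_mult_distrib2)
  finally have "of_nat ((p * k) choose (2 * p)) * of_nat ((p * 2) choose p) =
     (of_nat ((p * k) choose p) * of_nat ((p * (k - 1)) choose p) :: rat)"
    by (simp only: mult.commute[of 2 p] flip: of_nat_mult)
  then show ?thesis
    using that unfolding wolst_prod_of_nat by (simp add: of_nat_diff mult_ac)
qed

text \<open>Multiplied by p^5, the coefficients of \<open>frob_quot ^ 5\<close> at p and 2p are
  combinations of binomial coefficients, hence of values of \<open>wolst_prod\<close>. Knowing these
  modulo p^6 determines the coefficients modulo \<open>p\<close>.\<close>

lemma T_p:
  shows "pcong 1 (T p 1) (- 24 * bernoulli (p - 5))"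
    and "pcong 1 (T p 2) (48 * bernoulli (p - 5))"
proof -
  define B where "B = bernoulli (p - 5)"
  obtain \<alpha> \<beta> where \<alpha>: "\<alpha> \<in> pideal 3" and \<beta>: "\<beta> \<in> pideal 5"
    and \<beta>B: "pcong 6 (5 * \<beta>) (- (of_nat p ^ 5 * B))"
    and w: "\<And>n. pcong 6 (wolst_prod (of_nat n))
       (1 + \<alpha> * (of_nat n * (1 - of_nat n)) + \<beta> * (of_nat n * (1 - of_nat n)) ^ 2)"
    unfolding B_def by (rule wolst_prod_expansion) blast
  define \<epsilon> where "\<epsilon> x = \<alpha> * (x * (1 - x)) + \<beta> * (x * (1 - x)) ^ 2" for x
  have w': "pcong 6 (wolst_prod (of_nat n)) (1 + \<epsilon> (of_nat n))" for n
    using w[of n] by (simp add: \<epsilon>_def add.assoc)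
  have \<epsilon>: "\<epsilon> (of_nat n) \<in> pideal 3" for n
    unfolding \<epsilon>_def by (intro pideal_add pideal_mult_right local_mult local_power local_diff
      \<alpha> pideal_mono[OF \<beta>]) simp_all
  \<comment> \<open>The deviations from 1 are divisible by p^3, so their product vanishes modulo
    p^6.\<close>
  have ww: "pcong 6 (wolst_prod (of_nat m) * wolst_prod (of_nat n)) (1 + \<epsilon> (of_nat m) + \<epsilon> (of_nat n))" for m n
  proof -
    have loc: "1 + \<epsilon> (of_nat k) \<in> Z" for k
      using pideal_local[OF \<epsilon>] by (intro local_add) simp_all
    have "pcong 6 (wolst_prod (of_nat m) * wolst_prod (of_nat n)) ((1 + \<epsilon> (of_nat m)) * (1 + \<epsilon> (of_nat n)))"
      by (intro pcong_mult w' loc pcong_local[OF w' loc])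
    moreover have "\<epsilon> (of_nat m) * \<epsilon> (of_nat n) \<in> pideal (3 + 3)"
      by (intro pideal_mult \<epsilon>)
    then have "pcong 6 ((1 + \<epsilon> (of_nat m)) * (1 + \<epsilon> (of_nat n))) (1 + \<epsilon> (of_nat m) + \<epsilon> (of_nat n))"
      by (simp add: pcong_def algebra_simps)
    ultimately show ?thesis by (rule pcong_trans)
  qed
  note w2 = w'[of 2, simplified] and w3 = w'[of 3, simplified] and w4 = w'[of 4, simplified]
    and w5 = w'[of 5, simplified]
  have w1: "wolst_prod 1 = 1" using wolst_prod_reflect[of 0] by (simp add: wolst_prod_def)
  have N: "of_nat ((p * 1) choose p) = (1 :: rat)"
    "of_nat ((p * 2) choose p) = 2 * wolst_prod 2" "of_nat ((p * 3) choose p) = 3 * wolst_prod 3"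
    "of_nat ((p * 4) choose p) = 4 * wolst_prod 4" "of_nat ((p * 5) choose p) = 5 * wolst_prod 5"
    unfolding wolst_prod_of_nat using w1 by simp_all
  have "(2 * p) choose p > 0" by simp
  then have w2_nz: "wolst_prod 2 \<noteq> 0" using N(2) by (auto simp: mult.commute)
  have M: "of_nat ((p * 3) choose (2 * p)) = 3 * wolst_prod 3"
    "wolst_prod 2 * of_nat ((p * 4) choose (2 * p)) = 6 * (wolst_prod 4 * wolst_prod 3)"
    "wolst_prod 2 * of_nat ((p * 5) choose (2 * p)) = 10 * (wolst_prod 5 * wolst_prod 4)"
    using choose_2p[of 3] choose_2p[of 4] choose_2p[of 5] w2_nz by simp_all
  have M0: "(p * 1) choose (2 * p) = 0" "(p * 2) choose (2 * p) = 1"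
    by (simp_all add: mult.commute)
  have "of_nat p ^ 5 * (frob_quot ^ 5) $ (p * 1) =
      5 + - 20 * wolst_prod 2 + 30 * wolst_prod 3 + - 20 * wolst_prod 4 + 5 * wolst_prod 5"
    unfolding frob_quot_power_nth Let_def mult_1_right truncated_coeffs
    using N by (simp add: algebra_simps)
  also have "pcong 6 \<dots> (5 + - 20 * (1 + \<epsilon> 2) + 30 * (1 + \<epsilon> 3) + - 20 * (1 + \<epsilon> 4) + 5 * (1 + \<epsilon> 5))"
    by (intro pcong_add pcong_refl pcong_mult_left w2 w3 w4 w5) simp_all
  \<comment> \<open>At 2, 3, 4, 5 the values of x(1 - x) are -2, -6, -12, -20: the constants and the
    multiples of \<alpha> cancel, and \<beta> keeps the factor 120.\<close>
  also have "\<dots> = 24 * (5 * \<beta>)"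
    by (simp add: \<epsilon>_def)
  also have "pcong 6 \<dots> (24 * (- (of_nat p ^ 5 * B)))"
    by (intro pcong_mult_left \<beta>B) simp
  also have "\<dots> = of_nat p ^ 5 * (- 24 * B)" by simp
  finally have "pcong 1 ((frob_quot ^ 5) $ (p * 1)) (- 24 * B)"
    using pcong_cancel_p[of 5 1 "(frob_quot ^ 5) $ (p * 1)" "- 24 * B"] by simp
  with T_p_pcong[of 1] show "pcong 1 (T p 1) (- 24 * bernoulli (p - 5))"
    unfolding B_def by (blast intro: pcong_trans pcong_sym)
  define c where "c = of_nat p ^ 5 * (frob_quot ^ 5) $ (p * 2)"
  have c5: "c \<in> pideal 5"
    unfolding c_def by (intro pideal_mult_right frob_quot_power_local) simp
  have c: "c = - 10 - 10 * of_nat ((p * 3) choose (2 * p)) + 5 * of_nat ((p * 4) choose (2 * p))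
      - of_nat ((p * 5) choose (2 * p)) + 60 * wolst_prod 2 - 60 * wolst_prod 3 + 20 * wolst_prod 4"
    unfolding c_def frob_quot_power_nth Let_def mult.commute[of p 2] truncated_coeffs
    using N M0 by (simp add: algebra_simps binomial_eq_0)
  \<comment> \<open>Two of the binomial coefficients have \<open>wolst_prod 2\<close> as
    denominator; multiplying by it leaves products of at most two values.\<close>
  have "c * wolst_prod 2 = - 10 * wolst_prod 2 + - 30 * (wolst_prod 3 * wolst_prod 2)
      + 5 * (wolst_prod 2 * of_nat ((p * 4) choose (2 * p)))
      + - 1 * (wolst_prod 2 * of_nat ((p * 5) choose (2 * p)))
      + 60 * (wolst_prod 2 * wolst_prod 2) + - 60 * (wolst_prod 3 * wolst_prod 2) + 20 * (wolst_prod 4 * wolst_prod 2)"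
    unfolding c M(1) by (simp add: algebra_simps)
  then have cw: "c * wolst_prod 2 = - 10 * wolst_prod 2 + - 30 * (wolst_prod 3 * wolst_prod 2)
      + 30 * (wolst_prod 4 * wolst_prod 3) + - 10 * (wolst_prod 5 * wolst_prod 4)
      + 60 * (wolst_prod 2 * wolst_prod 2) + - 60 * (wolst_prod 3 * wolst_prod 2) + 20 * (wolst_prod 4 * wolst_prod 2)"
    unfolding M by simp
  \<comment> \<open>Again the constants and the multiples of \<alpha> cancel.\<close>
  have \<beta>_eq: "- 10 * (1 + \<epsilon> 2) + - 30 * (1 + \<epsilon> 3 + \<epsilon> 2)
      + 30 * (1 + \<epsilon> 4 + \<epsilon> 3) + - 10 * (1 + \<epsilon> 5 + \<epsilon> 4)
      + 60 * (1 + \<epsilon> 2 + \<epsilon> 2) + - 60 * (1 + \<epsilon> 3 + \<epsilon> 2) + 20 * (1 + \<epsilon> 4 + \<epsilon> 2)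
      = - 48 * (5 * \<beta>)"
    by (simp add: \<epsilon>_def)
  have "pcong 6 (c * wolst_prod 2) (- 48 * (5 * \<beta>))"
    unfolding cw \<beta>_eq[symmetric]
    using ww[of 3 2] ww[of 4 3] ww[of 5 4] ww[of 2 2] ww[of 4 2]
    by (intro pcong_add pcong_mult_left w2) simp_all
  also have "pcong 6 \<dots> (- 48 * (- (of_nat p ^ 5 * B)))"
    by (intro pcong_mult_left \<beta>B) simp
  finally have "pcong 6 (c * wolst_prod 2) (of_nat p ^ 5 * (48 * B))"
    by (simp add: mult.left_commute)
  \<comment> \<open>As p^5 divides \<open>c\<close>, the factor \<open>wolst_prod 2\<close>, which
    is 1 modulo \<open>p\<close>, may be dropped modulo p^6.\<close>
  moreover have "c * (1 - wolst_prod 2) \<in> pideal (5 + 1)"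
  proof (rule pideal_mult[OF c5])
    have "pcong 1 (wolst_prod 2) (1 + \<epsilon> 2)" by (rule pcong_mono[OF w2]) simp
    also have "pcong 1 (1 + \<epsilon> 2) (1 + 0)"
      using \<epsilon>[of 2] by (intro pcong_add) (simp_all add: pcong_0_iff pideal_mono)
    finally have "pcong 1 (wolst_prod 2) 1" by simp
    then have "pcong 1 1 (wolst_prod 2)" by (rule pcong_sym)
    then show "1 - wolst_prod 2 \<in> pideal 1" by (simp add: pcong_def)
  qed
  then have "pcong 6 c (c * wolst_prod 2)" by (simp add: pcong_def algebra_simps)
  ultimately have "pcong 6 c (of_nat p ^ 5 * (48 * B))" using pcong_trans by blast
  then have "pcong 1 ((frob_quot ^ 5) $ (p * 2)) (48 * B)"
    unfolding c_def using pcong_cancel_p[of 5 1 "(frob_quot ^ 5) $ (p * 2)" "48 * B"] by simp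
  with T_p_pcong[of 2] show "pcong 1 (T p 2) (48 * bernoulli (p - 5))"
    unfolding B_def by (blast intro: pcong_trans pcong_sym)
qed

subsection \<open>The congruences for all powers of \<open>p\<close>\<close>

text \<open>The weights satisfy c_1 = (x^3 + x)/2 + c_4 and c_2 = (x^3 - x)/6 + c_3. The error is
  thus a combination of T_1 + T_4 and T_2 + T_3, divisible by p^r, with coefficients c_4 and c_3
  that supply p^j.\<close>

lemma T_sum_pcong:
  assumes r: "r > 0" and q: "q = p ^ r"
    and c: "\<And>s. s \<in> {3, 4} \<Longrightarrow>
      (x - of_nat s + 1) * (x - of_nat s + 2) * (x - of_nat s + 3) * (x - of_nat s + 4) \<in> pideal j"
  shows "pcong (r + j) (\<Sum>s=1..4. T q s * ((x - of_nat s + 1) * (x - of_nat s + 2)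
        * (x - of_nat s + 3) * (x - of_nat s + 4) / 24))
     (T q 1 * ((x ^ 3 + x) / 2) + T q 2 * ((x ^ 3 - x) / 6))"
proof -
  define c where "c s = (x - of_nat s + 1) * (x - of_nat s + 2) * (x - of_nat s + 3)
    * (x - of_nat s + 4) / 24" for s :: nat
  have sym: "T q 3 + T q 2 \<in> pideal r" "T q 4 + T q 1 \<in> pideal r"
    using T_symmetric[of r q 2] T_symmetric[of r q 1] r q
    by (simp_all add: numeral_eq_Suc pcong_def)
  have "c 3 \<in> pideal j" "c 4 \<in> pideal j"
    using assms(3)[of 3] assms(3)[of 4] by (auto simp: c_def intro!: pideal_divide_small)
  then have "(T q 3 + T q 2) * c 3 + (T q 4 + T q 1) * c 4 \<in> pideal (r + j)"
    by (intro pideal_add pideal_mult sym)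
  moreover have "(\<Sum>s=1..4. T q s * c s) - (T q 1 * ((x ^ 3 + x) / 2) + T q 2 * ((x ^ 3 - x) / 6)) =
      (T q 3 + T q 2) * c 3 + (T q 4 + T q 1) * c 4"
  proof -
    have sum: "(\<Sum>s=1..4. T q s * c s) = T q 1 * c 1 + T q 2 * c 2 + T q 3 * c 3 + T q 4 * c 4"
      by (simp add: numeral_eq_Suc)
    have c: "c 1 = (x ^ 3 + x) / 2 + c 4" "c 2 = (x ^ 3 - x) / 6 + c 3"
      by (simp_all add: c_def field_simps eval_nat_numeral)
    show ?thesis unfolding sum c by (simp add: algebra_simps)
  qed
  ultimately show ?thesis by (simp only: pcong_def flip: c_def)
qed

lemma recip_sum5_pcong:
  assumes r: "r > 0" and q: "q = p ^ r"
  shows "pcong r (recip_sum5 p (q * m))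
    (T q 1 * ((of_nat m ^ 3 + of_nat m) / 2) + T q 2 * ((of_nat m ^ 3 - of_nat m) / 6))"
proof -
  have "pcong (r + 0) (\<Sum>s=1..4. T q s * ((of_nat m - of_nat s + 1) * (of_nat m - of_nat s + 2)
        * (of_nat m - of_nat s + 3) * (of_nat m - of_nat s + 4) / 24))
     (T q 1 * ((of_nat m ^ 3 + of_nat m) / 2) + T q 2 * ((of_nat m ^ 3 - of_nat m) / 6))"
    by (rule T_sum_pcong[OF r q]) (auto intro!: local_mult local_add local_diff)
  then show ?thesis using pcong_trans[OF recip_sum5_pcong_T[OF r q]] by simp
qed

text \<open>Take n = p^(r+1). At level r + 1 with m = 1 the weights are 1 and 0, so the sum is T_1.
  At level \<open>r\<close> with m = p the weights for s = 3, 4 contain the factor \<open>p\<close>,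
  which gains one power.\<close>

lemma T_power_step:
  assumes r: "r > 0"
  shows "pcong (r + 1) (T (p ^ (r + 1)) 1) (T (p ^ r) 1 * ((of_nat p ^ 3 + of_nat p) / 2)
     + T (p ^ r) 2 * ((of_nat p ^ 3 - of_nat p) / 6))"
proof -
  have "pcong (r + 1) (recip_sum5 p (p ^ (r + 1) * 1)) (T (p ^ (r + 1)) 1)"
    using recip_sum5_pcong[of "r + 1" "p ^ (r + 1)" 1] by simp
  then have "pcong (r + 1) (recip_sum5 p (p ^ r * p)) (T (p ^ (r + 1)) 1)"
    by (simp add: mult.commute)
  then have "pcong (r + 1) (T (p ^ (r + 1)) 1) (recip_sum5 p (p ^ r * p))"
    by (rule pcong_sym)
  also have "pcong (r + 1) \<dots> (\<Sum>s=1..4. T (p ^ r) s * ((of_nat p - of_nat s + 1)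
        * (of_nat p - of_nat s + 2) * (of_nat p - of_nat s + 3) * (of_nat p - of_nat s + 4) / 24))"
    by (rule recip_sum5_pcong_T_p[OF r refl])
  also have "pcong (r + 1) \<dots> (T (p ^ r) 1 * ((of_nat p ^ 3 + of_nat p) / 2)
     + T (p ^ r) 2 * ((of_nat p ^ 3 - of_nat p) / 6))"
  proof (rule T_sum_pcong[OF r refl])
    fix s :: nat assume "s \<in> {3, 4}"
    then have "(of_nat p - of_nat s + 3 :: rat) = of_nat p \<or> (of_nat p - of_nat s + 4 :: rat) = of_nat p"
      by auto
    moreover have "of_nat p - of_nat s + of_nat i \<in> Z" for i
      by (intro local_add local_diff local_of_nat)
    from this[of 1] this[of 2] this[of 3] this[of 4]
    have "of_nat p - of_nat s + 1 \<in> Z" "of_nat p - of_nat s + 2 \<in> Z" "of_nat p - of_nat s + 3 \<in> Z"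
      "of_nat p - of_nat s + 4 \<in> Z" by simp_all
    ultimately show "(of_nat p - of_nat s + 1) * (of_nat p - of_nat s + 2) * (of_nat p - of_nat s + 3)
        * (of_nat p - of_nat s + 4) \<in> pideal 1"
      by (metis pideal_p pideal_mult_left pideal_mult_right local_mult)
  qed
  finally show ?thesis .
qed

text \<open>The base case is - 24 p/2 - 48 p/6 = - 20 p, modulo p^2. In the step, T_2 = - 3 T_1
  merges the two weights into \<open>p\<close>. As the weights are divisible by \<open>p\<close>,
  congruences one power weaker suffice for T_1 and T_2.\<close>

lemma T_power_1:
  "pcong (k + 2) (T (p ^ (k + 2)) 1) (- 20 * (of_nat p ^ (k + 1) * bernoulli (p - 5)))"
proof (induction k)
  case 0
  define x where "x = (of_nat p :: rat)"
  define B where "B = bernoulli (p - 5)"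
  have B: "B \<in> Z" unfolding B_def by (rule bernoulli_local) simp
  have x: "x \<in> pideal 1" unfolding x_def by (rule pideal_p)
  then have x3: "x ^ 3 \<in> pideal 1"
    using pideal_mult_right[OF x local_power[OF pideal_local[OF x], of 2]]
    by (simp add: eval_nat_numeral)
  have "pcong (1 + 1) (T (p ^ (1 + 1)) 1) (T (p ^ 1) 1 * ((x ^ 3 + x) / 2)
     + T (p ^ 1) 2 * ((x ^ 3 - x) / 6))"
    unfolding x_def by (rule T_power_step) simp
  also have "pcong (1 + 1) \<dots> (- 24 * B * ((x ^ 3 + x) / 2) + 48 * B * ((x ^ 3 - x) / 6))"
  proof (rule pcong_add)
    have *: "pcong (1 + 1) (s * z) (t * z)" if "pcong 1 s t" "z \<in> pideal 1" for s t z
      using pideal_mult[OF that[unfolded pcong_def]] by (simp add: pcong_def algebra_simps)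
    show "pcong (1 + 1) (T (p ^ 1) 1 * ((x ^ 3 + x) / 2)) (- 24 * B * ((x ^ 3 + x) / 2))"
      using T_p(1) x x3 by (intro * pideal_divide_small pideal_add) (simp_all add: B_def)
    show "pcong (1 + 1) (T (p ^ 1) 2 * ((x ^ 3 - x) / 6)) (48 * B * ((x ^ 3 - x) / 6))"
      using T_p(2) x x3 by (intro * pideal_divide_small pideal_diff) (simp_all add: B_def)
  qed
  also have "\<dots> = - 20 * (x * B) - x ^ 2 * (4 * x * B)"
    by (simp add: field_simps eval_nat_numeral)
  also have "pcong (1 + 1) \<dots> (- 20 * (x * B) - 0)"
  proof (rule pcong_diff)
    have "x ^ 2 * (4 * x * B) \<in> pideal 2"
      unfolding x_def by (intro pideal_mult_right[OF pideal_p_power] local_mult B) simp_all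
    then show "pcong (1 + 1) (x ^ 2 * (4 * x * B)) 0"
      by (simp add: pcong_0_iff numeral_2_eq_2)
  qed simp
  finally show ?case by (simp add: x_def B_def numeral_2_eq_2)
next
  case (Suc k)
  define q where "q = p ^ (k + 2)"
  define x where "x = (of_nat p :: rat)"
  define B where "B = bernoulli (p - 5)"
  have x: "x \<in> pideal 1" unfolding x_def by (rule pideal_p)
  then have x3: "x ^ 3 \<in> pideal 1"
    using pideal_mult_right[OF x local_power[OF pideal_local[OF x], of 2]]
    by (simp add: eval_nat_numeral)
  have *: "pcong (k + 2 + 1) (s * z) (t * z)" if "pcong (k + 2) s t" "z \<in> pideal 1" for s t z
    using pideal_mult[OF that[unfolded pcong_def]] by (simp add: pcong_def algebra_simps)
  have "pcong (k + 2 + 1) (T (p ^ (k + 2 + 1)) 1) (T q 1 * ((x ^ 3 + x) / 2)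
     + T q 2 * ((x ^ 3 - x) / 6))"
    unfolding x_def q_def by (rule T_power_step) simp
  also have "pcong (k + 2 + 1) \<dots> (T q 1 * ((x ^ 3 + x) / 2) + (- 3 * T q 1) * ((x ^ 3 - x) / 6))"
    using x x3 by (intro pcong_add pcong_refl * T_pcong_2 pideal_divide_small pideal_diff)
      (simp_all add: q_def)
  also have "\<dots> = T q 1 * x"
    by (simp add: field_simps)
  also have "pcong (k + 2 + 1) \<dots> (- 20 * (x ^ (k + 1) * B) * x)"
    using Suc x by (intro *) (simp_all only: q_def x_def B_def)
  also have "\<dots> = - 20 * (x ^ (Suc k + 1) * B)" by simp
  finally show ?case by (simp add: x_def B_def)
qed

lemma recip_sum5_pcong_first_power:
  "pcong 1 (recip_sum5 p (p * m))
    (- (fact 4 / 6) * (5 * of_nat m + of_nat m ^ 3) * bernoulli (p - 5))"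
proof -
  define x where "x = (of_nat m :: rat)"
  have x: "x \<in> Z" by (simp add: x_def)
  have "pcong 1 (recip_sum5 p (p * m)) ((x ^ 3 + x) / 2 * T p 1 + (x ^ 3 - x) / 6 * T p 2)"
    using recip_sum5_pcong[of 1 p m] by (simp add: x_def mult.commute)
  also have "pcong 1 \<dots> ((x ^ 3 + x) / 2 * (- 24 * bernoulli (p - 5))
      + (x ^ 3 - x) / 6 * (48 * bernoulli (p - 5)))"
    using x by (intro pcong_add pcong_mult_left T_p local_divide_small local_add local_diff local_power)
  also have "\<dots> = - (fact 4 / 6) * (5 * x + x ^ 3) * bernoulli (p - 5)"
    by (simp add: fact_numeral field_simps)
  finally show ?thesis by (simp only: x_def)
qed

text \<open>With T_2 = - 3 T_1 the cubic terms cancel and the weight of T_1 is \<open>m\<close>;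
  \<open>T_power_1\<close> evaluates T_1.\<close>

lemma recip_sum5_pcong_higher_power:
  assumes r: "r \<ge> 2"
  shows "pcong r (recip_sum5 p (p ^ r * m))
    (- (fact 5 / 6) * (of_nat p ^ (r - 1) * of_nat m) * bernoulli (p - 5))"
proof -
  define x where "x = (of_nat m :: rat)"
  define q where "q = p ^ r"
  have x: "x \<in> Z" by (simp add: x_def)
  have "pcong r (recip_sum5 p (q * m)) ((x ^ 3 + x) / 2 * T q 1 + (x ^ 3 - x) / 6 * T q 2)"
    using recip_sum5_pcong[of r q m] r by (simp add: x_def q_def mult.commute)
  also have "pcong r \<dots> ((x ^ 3 + x) / 2 * T q 1 + (x ^ 3 - x) / 6 * (- 3 * T q 1))"
    using x by (intro pcong_add pcong_refl pcong_mult_left T_pcong_2 r q_def local_divide_small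
        local_diff local_power)
  also have "\<dots> = x * T q 1" by (simp add: field_simps)
  also have "pcong r \<dots> (x * (- 20 * (of_nat p ^ (r - 1) * bernoulli (p - 5))))"
  proof (rule pcong_mult_left[OF x])
    obtain k where "r = k + 2" using r by (metis le_add_diff_inverse2)
    then show "pcong r (T q 1) (- 20 * (of_nat p ^ (r - 1) * bernoulli (p - 5)))"
      using T_power_1[of k] by (simp add: q_def)
  qed
  also have "\<dots> = - (fact 5 / 6) * (of_nat p ^ (r - 1) * x) * bernoulli (p - 5)"
    by (simp add: fact_numeral)
  finally show ?thesis by (simp only: x_def q_def)
qed

end

section \<open>Both congruences for n = p^r m\<close>

theorem theorem1p2:
  fixes p n r :: nat
  assumes "prime p" and "p > 5" and "n > 0"
    and "r > 0" and "p ^ r dvd n" and "\<not> p ^ (r + 1) dvd n"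
  shows "(r = 1 \<longrightarrow>
            local_cong p (recip_sum5 p n)
              (- (fact 4 / 6) * (5 * (of_nat n / of_nat p) + (of_nat n / of_nat p) ^ 3)
                * bernoulli (p - 5)) p)
       \<and> (r \<ge> 2 \<longrightarrow>
            local_cong p (recip_sum5 p n)
              (- (fact 5 / 6) * (of_nat n / of_nat p) * bernoulli (p - 5)) (p ^ r))"
proof -
  interpret prime_gt_5 p by unfold_locales (fact assms)+
  from assms(5) obtain m where n: "n = p ^ r * m" by blast
  have B: "bernoulli (p - 5) \<in> local_ints p" by (rule bernoulli_local) simp
  have "local_cong p (recip_sum5 p n)
      (- (fact 4 / 6) * (5 * (of_nat n / of_nat p) + (of_nat n / of_nat p) ^ 3)
        * bernoulli (p - 5)) (p ^ 1)" if "r = 1"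
  proof -
    have np: "of_nat n / of_nat p = (of_nat m :: rat)" using n that by simp
    have "- (fact 4 / 6) = (- 4 :: rat)" by (simp add: fact_numeral)
    moreover have "- 4 * (5 * of_nat m + of_nat m ^ 3) * bernoulli (p - 5) \<in> local_ints p"
      using B by (intro local_mult local_add local_power) simp_all
    ultimately show ?thesis
      using recip_sum5_pcong_first_power[of m] n that unfolding local_cong_iff_pcong np by simp
  qed
  moreover have "local_cong p (recip_sum5 p n)
      (- (fact 5 / 6) * (of_nat n / of_nat p) * bernoulli (p - 5)) (p ^ r)" if r: "r \<ge> 2"
  proof -
    have np: "of_nat n / of_nat p = (of_nat p ^ (r - 1) * of_nat m :: rat)"
      using n r by (cases r) simp_all
    have "- (fact 5 / 6) = (- 20 :: rat)" by (simp add: fact_numeral)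
    moreover have "- 20 * (of_nat p ^ (r - 1) * of_nat m) * bernoulli (p - 5) \<in> local_ints p"
      using B by (intro local_mult local_power) simp_all
    ultimately show ?thesis
      using recip_sum5_pcong_higher_power[OF r, of m] unfolding local_cong_iff_pcong np unfolding n by simp
  qed
  ultimately show ?thesis by simp
qed

end
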